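(* Let $\alpha>0$ and $v,w>0$ be real numbers. Then, as $|t|\to\infty$, \[ \zeta_2\left(\tfrac32+it,\alpha;v,w\right)\ll|t|^{1/3}. \]
   Context: For $\alpha>0$ and $v,w>0$, the Barnes double zeta-function is $\zeta_2(s,\alpha;v,w)=\sum_{m=0}^\infty\sum_{n=0}^\infty(\alpha+vm+wn)^{-s}$ (absolutely convergent for $\mathrm{Re}(s)>2$, continued meromorphically to $\mathbb{C}$). *)

theory Defs
  imports "HOL-Complex_Analysis.Complex_Analysis" "HOL-Library.Landau_Symbols"
begin

definition barnes_zeta2_series :: "real \<Rightarrow> real \<Rightarrow> real \<Rightarrow> complex \<Rightarrow> complex" where
  "barnes_zeta2_series \<alpha> v w s =
     (\<Sum>m. \<Sum>n. complex_of_real (\<alpha> + v * real m + w * real n) powr (- s))"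

text \<open>
  The Barnes double zeta-function is the meromorphic continuation of the series to the whole
  complex plane. Since functions are total, meromorphy alone would leave the value arbitrary on
  a discrete set; requiring \<^const>\<open>nicely_meromorphic_on\<close> (the function is continuous away from
  its poles and takes the value 0 at them) makes the continuation unique. The definite
  description is meaningful for \<open>\<alpha>, v, w > 0\<close>.
\<close>

definition barnes_zeta2 :: "real \<Rightarrow> real \<Rightarrow> real \<Rightarrow> complex \<Rightarrow> complex" where
  "barnes_zeta2 \<alpha> v w =
     (THE Z. Z nicely_meromorphic_on UNIV \<and>
             (\<forall>s. Re s > 2 \<longrightarrow> Z s = barnes_zeta2_series \<alpha> v w s))"

end

theory Submission
  imports Defs
begin

text \<open>
  Write \<open>\<zeta>\<^sub>2(s, x)\<close> as the sum over \<open>m\<close> of Hurwitz series \<open>H(s, x + vm)\<close>.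
  Integration by parts gives \<open>x\<^sup>-\<^sup>s\<close> as a telescoping difference plus
  \<open>(s/w) \<integral>\<^sub>0\<^sup>w (w - u) (x + u)\<^sup>-\<^sup>s\<^sup>-\<^sup>1 du\<close>; summing this identity over the lattice expresses
  \<open>H(s, x)\<close> and \<open>\<zeta>\<^sub>2(s, x)\<close> through their values at \<open>s + 1\<close>. Multiplied by \<open>s - 1\<close>, respectively
  \<open>(s - 1)(s - 2)\<close>, the recursion has no poles, and iterating it yields the continuation
  together with an explicit formula for \<open>Re s > 1\<close>, in which \<open>\<zeta>\<^sub>2\<close> is, up to a bounded
  term, the sum over \<open>m\<close> of \<open>H(s, x) - x\<^sup>1\<^sup>-\<^sup>s / (w(s - 1))\<close> at \<open>x = \<alpha> + vm\<close>.

  On the line \<open>Re s = 3/2\<close> put \<open>T = \<bar>t\<bar>\<^sup>9\<^sup>/\<^sup>8\<close>. For \<open>x \<ge> T\<close> the trapezoidal rule suffices.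
  For \<open>x < T\<close> the part of the Hurwitz series up to \<open>T\<close> is cut dyadically; a block
  starting at \<open>y \<ge> \<bar>t\<bar>\<^sup>1\<^sup>/\<^sup>2\<close> is estimated by van der Corput differencing with about \<open>y / \<bar>t\<bar>\<^sup>1\<^sup>/\<^sup>2\<close> shifts.
  With the weight \<open>1/y\<close>, the correlations have the exact antiderivative
  \<open>((y + a) / (y + b))\<^sup>-\<^sup>i\<^sup>t\<close>, so they need only a comparison of sum and integral. The
  total is \<open>O(\<bar>t\<bar>\<^sup>5\<^sup>/\<^sup>1\<^sup>6 log\<^sup>2 \<bar>t\<bar>)\<close>, with \<open>5/16 < 1/3\<close>.
\<close>

section \<open>Lattice sums\<close>

definition pw :: "complex \<Rightarrow> real \<Rightarrow> complex" where
  "pw s x = complex_of_real x powr (- s)"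

text \<open>It acts on families indexed by \<open>s\<close> and \<open>x\<close> so that it can be
  iterated: \<open>lattice_sum w pw\<close> is the Hurwitz series with step \<open>w\<close>, and a
  further \<open>lattice_sum v\<close> gives the double series with \<open>m\<close> as outer
  index.\<close>

definition lattice_sum :: "real \<Rightarrow> (complex \<Rightarrow> real \<Rightarrow> complex) \<Rightarrow> complex \<Rightarrow> real \<Rightarrow> complex" where
  "lattice_sum w f s x = (\<Sum>n. f s (x + w * real n))"

lemma barnes_zeta2_series_eq:
  "barnes_zeta2_series \<alpha> v w s = lattice_sum v (lattice_sum w pw) s \<alpha>"
  unfolding barnes_zeta2_series_def lattice_sum_def pw_def ..

lemma norm_pw: "x > 0 \<Longrightarrow> norm (pw s x) = x powr (- Re s)"
  unfolding pw_def by (subst norm_powr_real_powr) auto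

lemma has_vector_derivative_pw:
  assumes "x + u > 0"
  shows "((\<lambda>u. pw s (x + u)) has_vector_derivative (- s * pw (s + 1) (x + u))) (at u within A)"
proof -
  have "((\<lambda>z. z powr (-s)) has_field_derivative (- s * complex_of_real (x + u) powr (- s - 1)))
          (at (complex_of_real (x + u)))"
    using assms by (intro has_field_derivative_powr) (auto simp: complex_nonpos_Reals_iff)
  moreover have "((\<lambda>u. complex_of_real (x + u)) has_vector_derivative 1) (at u within A)"
    unfolding of_real_add by (auto intro!: derivative_eq_intros)
  ultimately have "((\<lambda>z. z powr (-s)) \<circ> (\<lambda>u. complex_of_real (x + u)) has_vector_derivative
      1 * (- s * complex_of_real (x + u) powr (- s - 1))) (at u within A)"
    by (intro field_vector_diff_chain_within) (auto intro: has_field_derivative_at_within)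
  moreover have "- s - 1 = - (s + 1)" by simp
  ultimately show ?thesis by (simp only: pw_def o_def mult_1_left)
qed

lemma norm_diff_le_of_vector_derivative:
  fixes f :: "real \<Rightarrow> complex"
  assumes "0 \<le> w"
    and "\<And>u. u \<in> {0..w} \<Longrightarrow> (f has_vector_derivative f' u) (at u within {0..w})"
    and "\<And>u. u \<in> {0..w} \<Longrightarrow> norm (f' u) \<le> B"
  shows "norm (f w - f 0) \<le> B * w"
proof -
  have "norm (f w - f 0) \<le> B * norm (w - 0)"
  proof (rule differentiable_bound[where S = "{0..w}" and f' = "\<lambda>x h. h *\<^sub>R f' x"])
    fix u assume u: "u \<in> {0..w}"
    show "onorm (\<lambda>h. h *\<^sub>R f' u) \<le> B"
      by (rule onorm_le) (use mult_left_mono[OF assms(3)[OF u] abs_ge_zero] in \<open>simp add: mult.commute\<close>)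
  qed (use assms in \<open>auto simp: has_vector_derivative_def\<close>)
  thus ?thesis using assms(1) by simp
qed

section \<open>Comparison of power sums with integrals\<close>

lemma powr_diff_step_ge:
  fixes p :: real
  assumes "y > 0" "w > 0" "p > 1"
  shows "w * (p - 1) * (y + w) powr (- p) \<le> y powr (1 - p) - (y + w) powr (1 - p)"
proof -
  have "\<exists>z>y. z < y + w \<and> (y + w) powr (1-p) - y powr (1-p) = (y + w - y) * ((1-p) * z powr (-p))"
  proof (rule MVT2)
    fix x assume "y \<le> x" "x \<le> y + w"
    thus "((\<lambda>x. x powr (1-p)) has_real_derivative (1-p) * x powr (-p)) (at x)"
      using assms by (auto intro!: derivative_eq_intros)
  qed (use assms in auto)
  then obtain z where z: "z > y" "z < y + w"
    "(y + w) powr (1-p) - y powr (1-p) = w * ((1-p) * z powr (-p))" by auto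
  have "z powr (-p) \<ge> (y + w) powr (-p)"
    using z assms by (intro powr_mono2') auto
  hence "w * (p - 1) * z powr (-p) \<ge> w * (p - 1) * (y + w) powr (-p)"
    using assms by (intro mult_left_mono) auto
  thus ?thesis using z(3) by (simp add: algebra_simps)
qed

text \<open>The term \<open>n = 0\<close> is kept apart; every later term is bounded by a difference
  of powers of exponent \<open>1 - p\<close> through the mean value theorem, and these telescope.
  The bound is independent of \<open>N\<close>, so it yields both the convergence and the size of
  the series.\<close>

lemma sum_powr_le:
  fixes p :: real
  assumes "x > 0" "w > 0" "p > 1"
  shows "(\<Sum>n<N. (x + w * real n) powr (- p)) \<le> x powr (- p) + x powr (1 - p) / (w * (p - 1))"
proof -
  have pos: "w * (p - 1) > 0" using assms by simp
  have "(\<Sum>n<N. (x + w * real n) powr (- p)) \<le> (\<Sum>n<Suc N. (x + w * real n) powr (- p))"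
    by simp
  also have "\<dots> = x powr (-p) + (\<Sum>n<N. (x + w * real (Suc n)) powr (- p))"
    by (subst sum.lessThan_Suc_shift) simp
  also have "(\<Sum>n<N. (x + w * real (Suc n)) powr (- p)) \<le>
      (\<Sum>n<N. ((x + w * real n) powr (1-p) - (x + w * real (Suc n)) powr (1-p)) / (w * (p - 1)))"
  proof (rule sum_mono)
    fix n
    have "x + w * real n > 0" using assms by (simp add: add_pos_nonneg)
    from powr_diff_step_ge[OF this assms(2,3)] pos
    show "(x + w * real (Suc n)) powr (- p) \<le>
      ((x + w * real n) powr (1-p) - (x + w * real (Suc n)) powr (1-p)) / (w * (p - 1))"
      by (simp add: field_simps)
  qed
  also have "\<dots> = (x powr (1-p) - (x + w * real N) powr (1-p)) / (w * (p - 1))"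
    by (simp add: sum_divide_distrib[symmetric] sum_lessThan_telescope'[where f = "\<lambda>n. (x + w * real n) powr (1-p)", simplified])
  also have "\<dots> \<le> x powr (1-p) / (w * (p - 1))"
    using pos by (intro divide_right_mono) auto
  finally show ?thesis by simp
qed

lemma
  fixes p :: real
  assumes "x > 0" "w > 0" "p > 1"
  shows summable_powr_lattice: "summable (\<lambda>n. (x + w * real n) powr (- p))"
    and suminf_powr_le: "(\<Sum>n. (x + w * real n) powr (- p)) \<le> x powr (- p) + x powr (1 - p) / (w * (p - 1))"
proof -
  show s: "summable (\<lambda>n. (x + w * real n) powr (- p))"
    using sum_powr_le[OF assms] by (intro summableI_nonneg_bounded) auto
  show "(\<Sum>n. (x + w * real n) powr (- p)) \<le> x powr (- p) + x powr (1 - p) / (w * (p - 1))"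
    using sum_powr_le[OF assms] by (intro suminf_le_const s) auto
qed

section \<open>Families jointly continuous, holomorphic in \<open>s\<close> and decaying in
  \<open>x\<close>\<close>

definition regular :: "real \<Rightarrow> (complex \<Rightarrow> real \<Rightarrow> complex) \<Rightarrow> bool" where
  "regular c f \<longleftrightarrow> continuous_on ({s. Re s > c} \<times> {0<..}) (\<lambda>(s, x). f s x) \<and>
     (\<forall>x>0. (\<lambda>s. f s x) holomorphic_on {s. Re s > c})"

text \<open>The index \<open>c\<close> acts as an abscissa of convergence: it is \<open>0\<close>
  for \<open>pw\<close> and rises by one with each lattice sum. The exponent is frozen at the left
  edge \<open>a\<close> of the strip, which gives the M-test one majorant for all \<open>s\<close>
  in the strip.\<close>

definition decaying :: "real \<Rightarrow> (complex \<Rightarrow> real \<Rightarrow> complex) \<Rightarrow> bool" where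
  "decaying c f \<longleftrightarrow> (\<forall>a b x0. c < a \<longrightarrow> 0 < x0 \<longrightarrow>
     (\<exists>C\<ge>0. \<forall>s x. a \<le> Re s \<longrightarrow> Re s \<le> b \<longrightarrow> x0 \<le> x \<longrightarrow> norm (f s x) \<le> C * x powr (c - a)))"

lemma regular_mono: "regular c f \<Longrightarrow> c \<le> d \<Longrightarrow> regular d f"
  unfolding regular_def
  by (elim conjE, intro conjI allI impI)
     (erule continuous_on_subset, force, rule holomorphic_on_subset, blast, force)

lemma regular_continuous_on:
  assumes "regular c f" "Re s > c" "\<And>u. u \<in> A \<Longrightarrow> g u > 0" "continuous_on A g"
  shows "continuous_on A (\<lambda>u. f s (g u))"
proof -
  have 1: "continuous_on ({s. Re s > c} \<times> {0<..}) (\<lambda>(s, x). f s x)"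
    using assms(1) unfolding regular_def by blast
  have 2: "continuous_on A (\<lambda>u. (s, g u))"
    by (intro continuous_on_Pair continuous_on_const assms(4))
  have 3: "(\<lambda>u. (s, g u)) ` A \<subseteq> {s. Re s > c} \<times> {0<..}"
    using assms(2,3) by auto
  from continuous_on_compose2[OF 1 2 3] show ?thesis by simp
qed

lemma regular_pw: "regular c pw"
  unfolding regular_def
proof (intro conjI allI impI)
  have "continuous_on ({s. Re s > c} \<times> {0<..}) (\<lambda>p. exp (- fst p * complex_of_real (ln (snd p))))"
    by (intro continuous_intros) auto
  thus "continuous_on ({s. Re s > c} \<times> {0<..}) (\<lambda>(s, x). pw s x)"
    by (rule continuous_on_eq) (auto simp: pw_def powr_def Ln_of_real)
  show "(\<lambda>s. pw s x) holomorphic_on {s. Re s > c}" if "x > 0" for x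
    unfolding pw_def using that by (intro holomorphic_intros) auto
qed

lemma decaying_pw: "decaying 0 pw"
  unfolding decaying_def
proof (intro allI impI)
  fix a b x0 :: real assume a: "0 < a" and x0: "0 < x0"
  show "\<exists>C\<ge>0. \<forall>s x. a \<le> Re s \<longrightarrow> Re s \<le> b \<longrightarrow> x0 \<le> x \<longrightarrow> norm (pw s x) \<le> C * x powr (0 - a)"
  \<comment> \<open>For \<open>x \<ge> 1\<close> lowering \<open>Re s\<close> to \<open>a\<close>
    only enlarges the power; for \<open>x0 \<le> x < 1\<close> the loss is at most
    \<open>x0 powr (-(b - a))\<close>.\<close>
  proof (intro exI[of _ "max 1 (x0 powr (-(b - a)))"] conjI allI impI)
    fix s x assume s: "a \<le> Re s" "Re s \<le> b" and x: "x0 \<le> x"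
    have "x powr (-(Re s - a)) \<le> max 1 (x0 powr (-(b - a)))"
    proof (cases "x \<ge> 1")
      case True
      hence "x powr (-(Re s - a)) \<le> x powr 0"
        using s by (intro powr_mono) auto
      also have "\<dots> = 1" using True by simp
      finally show ?thesis by (rule max.coboundedI1)
    next
      case False
      have "x powr (-(Re s - a)) \<le> x powr (-(b - a))"
        using False x x0 s by (intro powr_mono') auto
      also have "\<dots> \<le> x0 powr (-(b - a))"
        using x x0 s by (intro powr_mono2') auto
      finally show ?thesis by (rule max.coboundedI2)
    qed
    hence "x powr (-(Re s - a)) * x powr (-a) \<le> max 1 (x0 powr (-(b - a))) * x powr (-a)"
      by (intro mult_right_mono) auto
    thus "norm (pw s x) \<le> max 1 (x0 powr (-(b - a))) * x powr (0 - a)"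
      using x x0 by (simp add: norm_pw flip: powr_add)
  qed auto
qed

lemma decayingE:
  assumes "decaying c f" "c < a" "0 < x0"
  obtains C where "C \<ge> 0"
    "\<And>s x. a \<le> Re s \<Longrightarrow> Re s \<le> b \<Longrightarrow> x0 \<le> x \<Longrightarrow> norm (f s x) \<le> C * x powr (c - a)"
proof -
  have "\<exists>C\<ge>0. \<forall>s x. a \<le> Re s \<longrightarrow> Re s \<le> b \<longrightarrow> x0 \<le> x \<longrightarrow> norm (f s x) \<le> C * x powr (c - a)"
    using assms unfolding decaying_def by simp
  thus ?thesis using that by blast
qed

lemma decaying_shiftE:
  assumes "decaying c f" "c < a" "0 < x0" "w > 0"
  obtains C where "C \<ge> 0"
    "\<And>s x n. a \<le> Re s \<Longrightarrow> Re s \<le> b \<Longrightarrow> x0 \<le> x \<Longrightarrow>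
       norm (f s (x + w * real n)) \<le> C * (x + w * real n) powr (-(a - c))"
proof -
  obtain C where C: "C \<ge> 0"
    "\<And>s x. a \<le> Re s \<Longrightarrow> Re s \<le> b \<Longrightarrow> x0 \<le> x \<Longrightarrow> norm (f s x) \<le> C * x powr (c - a)"
    using decayingE[OF assms(1-3), of b] by blast
  show ?thesis
  proof (rule that[OF C(1)])
    fix s x n assume s: "a \<le> Re s" "Re s \<le> b" "x0 \<le> x"
    have "x0 \<le> x + w * real n" using s(3) assms(4) by (simp add: add_increasing2)
    from C(2)[OF s(1,2) this]
    show "norm (f s (x + w * real n)) \<le> C * (x + w * real n) powr (-(a - c))" by simp
  qed
qed

lemma summable_lattice_sum:
  assumes "w > 0" "decaying c f" "Re s > c + 1" "x > 0"
  shows "summable (\<lambda>n. norm (f s (x + w * real n)))"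
proof -
  obtain C where C: "\<And>n. norm (f s (x + w * real n)) \<le> C * (x + w * real n) powr (-(Re s - c))"
  proof -
    have "c < Re s" using assms by simp
    from decaying_shiftE[OF assms(2) this assms(4,1), of "Re s"]
    show ?thesis by (metis order_refl that)
  qed
  have "summable (\<lambda>n. C * (x + w * real n) powr (-(Re s - c)))"
    using assms by (intro summable_mult summable_powr_lattice) auto
  thus ?thesis
    by (rule summable_comparison_test'[where N = 0]) (use C in simp)
qed

text \<open>The M-test with the majorant taken at \<open>x0\<close>, as the decay bound is antitone
  in \<open>x\<close>. Uniformity in both variables at once serves joint continuity and holomorphy
  in \<open>s\<close> alike.\<close>

lemma uniform_limit_lattice_sum:
  assumes "w > 0" "decaying c f" and a: "c + 1 < a" and x0: "0 < x0"
  shows "uniform_limit ({s. a \<le> Re s \<and> Re s \<le> b} \<times> {x0..})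
      (\<lambda>N (s, x). \<Sum>n<N. f s (x + w * real n)) (\<lambda>(s, x). lattice_sum w f s x) sequentially"
proof -
  have pos: "x + w * real n > 0" if "x > 0" for x n
    using that assms(1) by (simp add: add_pos_nonneg)
    obtain C where "C \<ge> 0" and C: "\<And>s x n. a \<le> Re s \<Longrightarrow> Re s \<le> b \<Longrightarrow> x0 \<le> x \<Longrightarrow>
       norm (f s (x + w * real n)) \<le> C * (x + w * real n) powr (-(a - c))"
      using decaying_shiftE[OF assms(2) less_trans[OF less_add_one a] x0 assms(1), of b] by blast
    have "uniform_limit ({s. a \<le> Re s \<and> Re s \<le> b} \<times> {x0..})
      (\<lambda>N z. \<Sum>n<N. (\<lambda>n (s, x). f s (x + w * real n)) n z) (\<lambda>z. \<Sum>n. (\<lambda>n (s, x). f s (x + w * real n)) n z) sequentially"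
    proof (rule Weierstrass_m_test)
      show "summable (\<lambda>n. C * (x0 + w * real n) powr (-(a - c)))"
        using a x0 assms(1) by (intro summable_mult summable_powr_lattice) auto
      fix n :: nat and z :: "complex \<times> real" assume z: "z \<in> {s. a \<le> Re s \<and> Re s \<le> b} \<times> {x0..}"
      have "norm ((\<lambda>(s, x). f s (x + w * real n)) z) \<le> C * (snd z + w * real n) powr (-(a - c))"
        using C z by (auto simp: case_prod_unfold)
      also have "\<dots> \<le> C * (x0 + w * real n) powr (-(a - c))"
        using z x0 a \<open>C \<ge> 0\<close> pos[of x0 n] by (intro mult_left_mono powr_mono2') auto
      finally show "norm ((\<lambda>(s, x). f s (x + w * real n)) z) \<le> C * (x0 + w * real n) powr (-(a - c))" .
    qed
  thus ?thesis by (simp add: case_prod_unfold lattice_sum_def)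
  qed

lemma regular_lattice_sum:
  assumes "w > 0" "regular c f" "decaying c f"
  shows "regular (c + 1) (lattice_sum w f)"
proof -
  have pos: "x + w * real n > 0" if "x > 0" for x n
    using that assms(1) by (simp add: add_pos_nonneg)
  have contn: "continuous_on ({s. Re s > c} \<times> {0<..}) (\<lambda>(s, x). f s (x + w * real n))" for n
  proof -
    have 1: "continuous_on ({s. Re s > c} \<times> {0<..}) (\<lambda>(s, x). f s x)"
      using assms(2) unfolding regular_def by blast
    have 2: "continuous_on ({s. Re s > c} \<times> {0<..}) (\<lambda>p. (fst p, snd p + w * real n))"
      by (intro continuous_intros)
    have 3: "(\<lambda>p. (fst p, snd p + w * real n)) ` ({s. Re s > c} \<times> {0<..}) \<subseteq> {s. Re s > c} \<times> {0<..}"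
      using pos by auto
    from continuous_on_compose2[OF 1 2 3] show ?thesis by (simp add: case_prod_unfold)
  qed
  show "regular (c + 1) (lattice_sum w f)"
    unfolding regular_def
  proof (intro conjI allI impI)
    have op: "open ({s. Re s > d} \<times> {e<..})" for d e :: real
      by (intro open_Times) (auto simp: open_halfspace_Re_gt)
    show "continuous_on ({s. Re s > c + 1} \<times> {0<..}) (\<lambda>(s, x). lattice_sum w f s x)"
      unfolding continuous_on_eq_continuous_at[OF op]
    proof
      fix p assume p: "p \<in> {s. Re s > c + 1} \<times> {0::real<..}"
      define s x where "s = fst p" and "x = snd p"
      have s: "Re s > c + 1" and x: "x > 0" and px: "p = (s, x)"
        using p by (auto simp: s_def x_def)
      \<comment> \<open>The left edge of the strip lies midway between \<open>c + 1\<close> and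
        \<open>Re s\<close>, and the half-line starts at \<open>x / 2\<close>: this gives an open
        neighbourhood of the point on which convergence is uniform.\<close>
      define a b x0 where "a = (c + 1 + Re s) / 2" and "b = Re s + 1" and "x0 = x / 2"
      define U where "U = ({s. a < Re s} \<inter> {s. Re s < b}) \<times> {x0<..}"
      have U: "open U" "(s, x) \<in> U"
        unfolding U_def by (intro open_Times open_Int open_halfspace_Re_gt open_halfspace_Re_lt open_greaterThan)
          (use s x in \<open>simp add: a_def b_def x0_def\<close>)
      have "uniform_limit U (\<lambda>N (s, x). \<Sum>n<N. f s (x + w * real n)) (\<lambda>(s, x). lattice_sum w f s x) sequentially"
        by (rule uniform_limit_on_subset[OF uniform_limit_lattice_sum[OF assms(1,3), of a x0 b]])
           (use s x in \<open>auto simp: U_def a_def x0_def b_def\<close>)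
      hence "continuous_on U (\<lambda>(s, x). lattice_sum w f s x)"
      proof (rule uniform_limit_theorem[rotated])
        have "continuous_on U (\<lambda>p. \<Sum>n<N. (\<lambda>(s, x). f s (x + w * real n)) p)" for N
          by (intro continuous_on_sum continuous_on_subset[OF contn])
             (use s x in \<open>auto simp: U_def a_def x0_def\<close>)
        thus "\<forall>\<^sub>F N in sequentially. continuous_on U (\<lambda>(s, x). \<Sum>n<N. f s (x + w * real n))"
          by (simp add: case_prod_unfold)
      qed auto
      thus "isCont (\<lambda>(s, x). lattice_sum w f s x) p"
        using U(2) unfolding px continuous_on_eq_continuous_at[OF U(1)] by (rule bspec)
    qed
    fix x :: real assume x: "x > 0"
    show "(\<lambda>s. lattice_sum w f s x) holomorphic_on {s. c + 1 < Re s}"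
    proof (rule holomorphic_uniform_sequence)
      show "open {s. c + 1 < Re s}" by (rule open_halfspace_Re_gt)
      show "(\<lambda>s. \<Sum>n<N. f s (x + w * real n)) holomorphic_on {s. c + 1 < Re s}" for N
      proof (intro holomorphic_on_sum)
        fix n
        have "(\<lambda>s. f s (x + w * real n)) holomorphic_on {s. Re s > c}"
          using assms(2) pos[OF x, of n] unfolding regular_def by blast
        thus "(\<lambda>s. f s (x + w * real n)) holomorphic_on {s. c + 1 < Re s}"
          by (rule holomorphic_on_subset) auto
      qed
      fix s assume s: "s \<in> {s. c + 1 < Re s}"
      \<comment> \<open>Half the distance to the line of real part \<open>c + 1\<close>, so that the
        closed disc stays inside the half-plane.\<close>
      define d where "d = (Re s - c - 1) / 2"
      have re: "\<bar>Re z - Re s\<bar> \<le> d" if "z \<in> cball s d" for z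
        using abs_Re_le_cmod[of "z - s"] that by (simp add: dist_norm norm_minus_commute)
      have sub: "cball s d \<subseteq> {z. (c + 1 + Re s) / 2 \<le> Re z \<and> Re z \<le> Re s + d}"
      proof
        fix z assume "z \<in> cball s d"
        from re[OF this] show "z \<in> {z. (c + 1 + Re s) / 2 \<le> Re z \<and> Re z \<le> Re s + d}"
          unfolding mem_Collect_eq d_def by argo
      qed
      have "uniform_limit (cball s d \<times> {x}) (\<lambda>N (s, x). \<Sum>n<N. f s (x + w * real n))
               (\<lambda>(s, x). lattice_sum w f s x) sequentially"
        by (rule uniform_limit_on_subset[OF uniform_limit_lattice_sum[OF assms(1,3), of "(c + 1 + Re s) / 2" x "Re s + d"]])
           (use s x sub in auto)
      hence "uniform_limit (cball s d) (\<lambda>N s. \<Sum>n<N. f s (x + w * real n)) (\<lambda>s. lattice_sum w f s x) sequentially"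
        by (auto simp: uniform_limit_iff)
      thus "\<exists>d>0. cball s d \<subseteq> {s. c + 1 < Re s} \<and>
          uniform_limit (cball s d) (\<lambda>N s. \<Sum>n<N. f s (x + w * real n)) (\<lambda>s. lattice_sum w f s x) sequentially"
        using s sub by (intro exI[of _ d]) (auto simp: d_def)
    qed
  qed
qed

text \<open>Summation costs one power of \<open>x\<close>, by comparison with the integral. The
  separate first term carries an extra factor \<open>1 / x \<le> 1 / x0\<close>, which accounts for
  the two summands of \<open>D\<close>.\<close>

lemma decaying_lattice_sum:
  assumes "w > 0" "decaying c f"
  shows "decaying (c + 1) (lattice_sum w f)"
proof -
  show "decaying (c + 1) (lattice_sum w f)"
    unfolding decaying_def
  proof (intro allI impI)
    fix a b x0 assume a: "c + 1 < a" and x0: "0 < (x0::real)"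
    obtain C where "C \<ge> 0" and C: "\<And>s x n. a \<le> Re s \<Longrightarrow> Re s \<le> b \<Longrightarrow> x0 \<le> x \<Longrightarrow>
       norm (f s (x + w * real n)) \<le> C * (x + w * real n) powr (-(a - c))"
      using decaying_shiftE[OF assms(2) less_trans[OF less_add_one a] x0 assms(1), of b] by blast
    define D where "D = C * (1 / x0 + 1 / (w * (a - c - 1)))"
    show "\<exists>D\<ge>0. \<forall>s x. a \<le> Re s \<longrightarrow> Re s \<le> b \<longrightarrow> x0 \<le> x \<longrightarrow> norm (lattice_sum w f s x) \<le> D * x powr (c + 1 - a)"
    proof (intro exI[of _ D] conjI allI impI)
      show "D \<ge> 0" using \<open>C \<ge> 0\<close> x0 a assms(1) by (simp add: D_def)
      fix s x assume s: "a \<le> Re s" "Re s \<le> b" and x: "x0 \<le> x"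
      have sm1: "summable (\<lambda>n. (x + w * real n) powr (-(a - c)))"
        using a x0 x assms(1) by (intro summable_powr_lattice) auto
      have "norm (lattice_sum w f s x) \<le> (\<Sum>n. norm (f s (x + w * real n)))"
        unfolding lattice_sum_def using s x x0 a by (intro summable_norm summable_lattice_sum[OF assms]) auto
      also have "\<dots> \<le> (\<Sum>n. C * (x + w * real n) powr (-(a - c)))"
        using C s x x0 a by (intro suminf_le summable_mult sm1 summable_lattice_sum[OF assms]) auto
      also have "\<dots> = C * (\<Sum>n. (x + w * real n) powr (-(a - c)))"
        by (intro suminf_mult sm1)
      also have "\<dots> \<le> C * (x powr (-(a - c)) + x powr (1 - (a - c)) / (w * (a - c - 1)))"
        using suminf_powr_le[of x w "a - c"] a x x0 assms(1) \<open>C \<ge> 0\<close> by (intro mult_left_mono) auto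
      also have "\<dots> = C * (x powr (c + 1 - a) / x + x powr (c + 1 - a) / (w * (a - c - 1)))"
      proof -
        have "x powr (- (a - c)) = x powr (c + 1 - a) / x"
          using powr_diff[of x "c + 1 - a" 1] x x0 by (simp add: algebra_simps)
        moreover have "x powr (1 - (a - c)) = x powr (c + 1 - a)" by (simp add: algebra_simps)
        ultimately show ?thesis by (simp only:)
      qed
      also have "\<dots> \<le> C * (x powr (c + 1 - a) / x0 + x powr (c + 1 - a) / (w * (a - c - 1)))"
        using x x0 \<open>C \<ge> 0\<close> by (intro mult_left_mono add_right_mono divide_left_mono) auto
      also have "\<dots> = D * x powr (c + 1 - a)"
        by (simp add: D_def algebra_simps)
      finally show "norm (lattice_sum w f s x) \<le> D * x powr (c + 1 - a)" .
    qed
  qed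
qed

section \<open>Extension to the left by a recursion\<close>

text \<open>Differentiation under the integral sign requires a jointly continuous derivative.
  Cauchy's formula on a small circle writes that derivative as an integral of \<open>f\<close>
  itself, so joint continuity of \<open>f\<close> is enough.\<close>

lemma holomorphic_on_integral_param:
  fixes f :: "complex \<Rightarrow> real \<Rightarrow> complex"
  assumes S: "open S"
    and cont: "continuous_on (S \<times> {a..b}) (\<lambda>(s, u). f s u)"
    and hol: "\<And>u. u \<in> {a..b} \<Longrightarrow> (\<lambda>s. f s u) holomorphic_on S"
  shows "(\<lambda>s. integral {a..b} (f s)) holomorphic_on S"
proof -
  have "(\<lambda>s. integral {a..b} (f s)) field_differentiable (at z)" if z: "z \<in> S" for z
  proof -
    obtain r where r: "r > 0" "cball z r \<subseteq> S"
      using S z open_contains_cball by blast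
    define \<gamma> where "\<gamma> = circlepath z r"
    define \<gamma>' where "\<gamma>' t = 2 * of_real pi * \<i> * r * exp (2 * of_real pi * \<i> * t)" for t :: real
    define fx where "fx s u = 1 / (2 * of_real pi * \<i>) *
      integral (cbox 0 1) (\<lambda>t. f (\<gamma> t) u / (\<gamma> t - s)\<^sup>2 * \<gamma>' t)" for s u
    have g: "\<gamma> t \<in> sphere z r" if "t \<in> {0..1}" for t
      using that r(1) path_image_circlepath_nonneg[of r z] unfolding path_image_def \<gamma>_def by auto
    have contg: "continuous_on A (\<lambda>x. \<gamma> (h x))" if "continuous_on A h" for A :: "((complex \<times> real) \<times> real) set" and h
      unfolding \<gamma>_def circlepath using that by (intro continuous_intros)
    have cfz: "continuous_on (cball z r) (\<lambda>s. f s u)" "(\<lambda>s. f s u) holomorphic_on ball z r" if "u \<in> {a..b}" for u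
    proof -
      show "continuous_on (cball z r) (\<lambda>s. f s u)"
        using hol[OF that] r(2) holomorphic_on_imp_continuous_on continuous_on_subset by blast
      show "(\<lambda>s. f s u) holomorphic_on ball z r"
        using hol[OF that] r(2) ball_subset_cball holomorphic_on_subset by blast
    qed
    have "(\<lambda>s. integral (cbox a b) (f s)) holomorphic_on ball z r"
    proof (rule leibniz_rule_holomorphic[where fx = fx])
      fix s u assume s: "s \<in> ball z r" and u: "u \<in> cbox a b"
      hence u': "u \<in> {a..b}" by simp
      have "contour_integral \<gamma> (\<lambda>v. f v u / (v - s)\<^sup>2) =
          integral (cbox 0 1) (\<lambda>t. f (\<gamma> t) u / (\<gamma> t - s)\<^sup>2 * \<gamma>' t)"
        unfolding contour_integral_integral cbox_interval
        by (intro integral_cong) (simp add: \<gamma>_def \<gamma>'_def vector_derivative_circlepath)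
      with Cauchy_derivative_integral_circlepath(2)[OF cfz[OF u'] s]
      have "((\<lambda>s. f s u) has_field_derivative fx s u) (at s)"
        unfolding fx_def \<gamma>_def by simp
      thus "((\<lambda>s. f s u) has_field_derivative fx s u) (at s within ball z r)"
        by (rule has_field_derivative_at_within)
    next
      fix s assume s: "s \<in> ball z r"
      have 2: "continuous_on {a..b} (\<lambda>u. (s, u))" by (intro continuous_intros)
      have 3: "(\<lambda>u. (s, u)) ` {a..b} \<subseteq> S \<times> {a..b}" using s r(2) by force
      from continuous_on_compose2[OF cont 2 3]
      show "f s integrable_on cbox a b" by (simp add: integrable_continuous_real)
    next
      have 1: "continuous_on ((ball z r \<times> cbox a b) \<times> cbox 0 1) (\<lambda>p. f (\<gamma> (snd p)) (snd (fst p)))"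
      proof -
        have 2: "continuous_on ((ball z r \<times> cbox a b) \<times> cbox 0 1) (\<lambda>p. (\<gamma> (snd p), snd (fst p)))"
          by (intro continuous_intros contg)
        have 3: "(\<lambda>p. (\<gamma> (snd p), snd (fst p))) ` ((ball z r \<times> cbox a b) \<times> cbox 0 1) \<subseteq> S \<times> {a..b}"
          using g r(2) by (force simp: subset_eq)
        from continuous_on_compose2[OF cont 2 3] show ?thesis by simp
      qed
      have ne: "\<gamma> (snd p) - fst (fst p) \<noteq> 0" if "p \<in> (ball z r \<times> cbox a b) \<times> cbox 0 1" for p
        using g[of "snd p"] that by (auto simp: dist_commute)
      have "continuous_on ((ball z r \<times> cbox a b) \<times> cbox 0 1)
          (\<lambda>p. f (\<gamma> (snd p)) (snd (fst p)) / (\<gamma> (snd p) - fst (fst p))\<^sup>2 * \<gamma>' (snd p))"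
        unfolding \<gamma>'_def using ne by (intro continuous_intros 1 contg) auto
      hence "continuous_on (ball z r \<times> cbox a b)
          (\<lambda>p. integral (cbox 0 1) (\<lambda>t. f (\<gamma> t) (snd p) / (\<gamma> t - fst p)\<^sup>2 * \<gamma>' t))"
        by (intro integral_continuous_on_param) (simp add: case_prod_unfold)
      thus "continuous_on (ball z r \<times> cbox a b) (\<lambda>(s, u). fx s u)"
        unfolding fx_def case_prod_unfold by (intro continuous_intros)
    qed auto
    thus ?thesis using r(1) holomorphic_on_imp_differentiable_at[of _ "ball z r" z] by simp
  qed
  thus ?thesis by (auto simp: holomorphic_on_def intro: field_differentiable_at_within)
qed

text \<open>The remainder left by an integration by parts over one step of length \<open>w\<close>.
  It samples \<open>f\<close> only at \<open>s + 1\<close>, and the whole continuation rests on this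
  gain of one unit in \<open>Re s\<close>.\<close>

definition tent_integral :: "real \<Rightarrow> (complex \<Rightarrow> real \<Rightarrow> complex) \<Rightarrow> complex \<Rightarrow> real \<Rightarrow> complex" where
  "tent_integral w f s x = integral {0..w} (\<lambda>u. of_real (w - u) * f (s + 1) (x + u))"

lemma tent_integral_integrable:
  assumes "regular c f" "Re s > c - 1" "x > 0"
  shows "(\<lambda>u. of_real (w - u) * f (s + 1) (x + u)) integrable_on {0..w}"
proof -
  have "continuous_on {0..w} (\<lambda>u. f (s + 1) (x + u))"
    by (rule regular_continuous_on[OF assms(1)]) (use assms in \<open>auto intro!: continuous_intros\<close>)
  thus ?thesis by (intro integrable_continuous_real continuous_intros)
qed

lemma regular_tent_integral:
  assumes "regular c f" "w > 0"
  shows "regular (c - 1) (tent_integral w f)"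
proof -
  have 1: "continuous_on ({s. Re s > c} \<times> {0<..}) (\<lambda>(s, x). f s x)"
    using assms(1) unfolding regular_def by blast
  have 2: "continuous_on (({s. Re s > c - 1} \<times> {0<..}) \<times> {0..w}) (\<lambda>p. (fst (fst p) + 1, snd (fst p) + snd p))"
    by (intro continuous_intros)
  have 3: "(\<lambda>p. (fst (fst p) + 1, snd (fst p) + snd p)) ` (({s. Re s > c - 1} \<times> {0<..}) \<times> {0..w}) \<subseteq> {s. Re s > c} \<times> {0<..}"
    by (auto intro: add_pos_nonneg)
  have 4: "continuous_on (({s. Re s > c - 1} \<times> {0<..}) \<times> {0..w})
      (\<lambda>p. of_real (w - snd p) * f (fst (fst p) + 1) (snd (fst p) + snd p))"
    using continuous_on_compose2[OF 1 2 3] by (intro continuous_intros) simp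
  show ?thesis unfolding regular_def
  proof (intro conjI allI impI)
    have "continuous_on ({s. Re s > c - 1} \<times> {0<..})
       (\<lambda>p. integral (cbox 0 w) (\<lambda>u. of_real (w - u) * f (fst p + 1) (snd p + u)))"
      using 4 by (intro integral_continuous_on_param) (simp add: case_prod_unfold)
    thus "continuous_on ({s. Re s > c - 1} \<times> {0<..}) (\<lambda>(s, x). tent_integral w f s x)"
      by (simp add: tent_integral_def case_prod_unfold)
    fix x :: real assume x: "x > 0"
    show "(\<lambda>s. tent_integral w f s x) holomorphic_on {s. Re s > c - 1}"
      unfolding tent_integral_def
    proof (rule holomorphic_on_integral_param)
      have 5: "continuous_on ({s. Re s > c - 1} \<times> {0..w}) (\<lambda>p. ((fst p, x), snd p))"
        by (intro continuous_intros)
      have 6: "(\<lambda>p. ((fst p, x), snd p)) ` ({s. Re s > c - 1} \<times> {0..w}) \<subseteq> ({s. Re s > c - 1} \<times> {0<..}) \<times> {0..w}"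
        using x by auto
      from continuous_on_compose2[OF 4 5 6]
      show "continuous_on ({s. Re s > c - 1} \<times> {0..w}) (\<lambda>(s, u). of_real (w - u) * f (s + 1) (x + u))"
        by (simp add: case_prod_unfold)
      fix u assume u: "u \<in> {0..w}"
      have "(\<lambda>s. f s (x + u)) holomorphic_on {s. Re s > c}"
        using assms(1) x u unfolding regular_def by auto
      hence "(\<lambda>s. f s (x + u)) \<circ> (\<lambda>s. s + 1) holomorphic_on {s. Re s > c - 1}"
        by (intro holomorphic_on_compose holomorphic_intros) (auto elim: holomorphic_on_subset)
      thus "(\<lambda>s. of_real (w - u) * f (s + 1) (x + u)) holomorphic_on {s. Re s > c - 1}"
        by (intro holomorphic_intros) (simp add: o_def)
    qed (rule open_halfspace_Re_gt)
  qed
qed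

lemma regular_add: "regular c f \<Longrightarrow> regular c g \<Longrightarrow> regular c (\<lambda>s x. f s x + g s x)"
  unfolding regular_def case_prod_unfold by (auto intro!: continuous_on_add holomorphic_on_add)

lemma regular_mult:
  assumes "p holomorphic_on UNIV" "regular c f"
  shows "regular c (\<lambda>s x. p s * f s x)"
proof -
  have "continuous_on UNIV p" using assms(1) by (rule holomorphic_on_imp_continuous_on)
  hence "continuous_on ({s. Re s > c} \<times> {0<..}) (\<lambda>q. p (fst q))"
    by (rule continuous_on_compose2) (auto intro: continuous_intros)
  moreover have "p holomorphic_on {s. Re s > c}" using assms(1) holomorphic_on_subset by blast
  ultimately show ?thesis using assms(2)
    unfolding regular_def case_prod_unfold by (auto intro!: continuous_on_mult holomorphic_on_mult)
qed

text \<open>Stage \<open>n\<close> applies the recursion \<open>n\<close> times, hence evaluates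
  \<open>F\<close> only at \<open>s + n\<close>, and reaches \<open>n\<close> units further left.
  The number \<open>k\<close> records the factor \<open>s - k\<close> that is left once the poles
  have been cleared.\<close>

primrec continue_left :: "(complex \<Rightarrow> real \<Rightarrow> complex) \<Rightarrow> complex \<Rightarrow> real \<Rightarrow> (complex \<Rightarrow> real \<Rightarrow> complex) \<Rightarrow> nat \<Rightarrow> complex \<Rightarrow> real \<Rightarrow> complex" where
  "continue_left G k w F 0 = F"
| "continue_left G k w F (Suc n) = (\<lambda>s x. G s x + (s - k) / w * tent_integral w (continue_left G k w F n) s x)"

lemma regular_continue_left:
  assumes "regular b F" "\<And>c. regular c G" "w > 0"
  shows "regular (b - real n) (continue_left G k w F n)"
proof (induction n)
  case (Suc n)
  have "regular (b - real n - 1) (tent_integral w (continue_left G k w F n))"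
    by (rule regular_tent_integral[OF Suc assms(3)])
  hence "regular (b - real n - 1) (\<lambda>s x. G s x + (s - k) / w * tent_integral w (continue_left G k w F n) s x)"
    using assms(3) by (intro regular_add regular_mult assms(2) holomorphic_intros) auto
  thus ?case by (simp add: algebra_simps)
qed (use assms in auto)

lemma tent_integral_cong:
  assumes "\<And>u. u \<in> {0..w} \<Longrightarrow> f (s + 1) (x + u) = g (s + 1) (x + u)"
  shows "tent_integral w f s x = tent_integral w g s x"
  unfolding tent_integral_def by (intro integral_cong) (simp add: assms)

text \<open>The recursion makes stage \<open>n + 1\<close> agree with stage \<open>n\<close>
  wherever the latter is already regular, so the stages glue to one function on the whole plane.
  Reading the glued function one stage later shows that it still satisfies the recursion.\<close>

theorem entire_extension:
  assumes "regular b F" "\<And>c. regular c G" "w > 0"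
    and rec: "\<And>s x. Re s > b \<Longrightarrow> x > 0 \<Longrightarrow> F s x = G s x + (s - k) / w * tent_integral w F s x"
  shows "\<exists>E. (\<forall>c. regular c E) \<and> (\<forall>s x. Re s > b \<longrightarrow> x > 0 \<longrightarrow> E s x = F s x) \<and>
    (\<forall>s x. x > 0 \<longrightarrow> E s x = G s x + (s - k) / w * tent_integral w E s x)"
proof -
  define C where "C = continue_left G k w F"
  have step: "C (Suc n) s x = C n s x" if "Re s > b - real n" "x > 0" for n s x
    using that
  proof (induction n arbitrary: s x)
    case 0
    thus ?case using rec[of s x] by (simp add: C_def)
  next
    case (Suc n)
    have "tent_integral w (C (Suc n)) s x = tent_integral w (C n) s x"
      using Suc.prems by (intro tent_integral_cong Suc.IH) auto
    thus ?case by (simp add: C_def)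
  qed
  have le: "C m s x = C n s x" if "n \<le> m" "Re s > b - real n" "x > 0" for m n s x
    using that(1)
  proof (induction m rule: dec_induct)
    case (step m)
    have "C (Suc m) s x = C m s x" using step that by (intro \<open>\<And>x s n. b - real n < Re s \<Longrightarrow> 0 < x \<Longrightarrow> C (Suc n) s x = C n s x\<close>) auto
    thus ?case using step by simp
  qed simp
  \<comment> \<open>A stage whose half-plane contains \<open>s\<close>; by \<open>le\<close>, any
    other such stage gives the same value.\<close>
  define N where "N s = nat (\<lceil>b - Re s\<rceil> + 1)" for s :: complex
  have N: "Re s > b - real (N s)" for s
    unfolding N_def by linarith
  define E where "E s x = C (N s) s x" for s x
  have E: "E s x = C n s x" if "Re s > b - real n" "x > 0" for n s x
    unfolding E_def using le[of n "max n (N s)" s x] le[of "N s" "max n (N s)" s x] N[of s] that by simp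
  show ?thesis
  proof (intro exI[of _ E] conjI allI impI)
    show "regular c E" for c
    proof -
      obtain n :: nat where n: "real n \<ge> b - c" using real_arch_simple by blast
      have "regular (b - real n) (C n)"
        unfolding C_def by (rule regular_continue_left[OF assms(1-3)])
      hence "regular c (C n)" using n by (auto elim: regular_mono)
      moreover have "E s x = C n s x" if "Re s > c" "x > 0" for s x
        using that n by (intro E) auto
      ultimately show ?thesis
        unfolding regular_def
        by (auto intro: continuous_on_eq[of _ "\<lambda>(s, x). C n s x"] holomorphic_transform[of "\<lambda>s. C n s x" for x])
    qed
    show "E s x = F s x" if "Re s > b" "x > 0" for s x
      using E[of 0 s x] that by (simp add: C_def)
    show "E s x = G s x + (s - k) / w * tent_integral w E s x" if "x > 0" for s x
    proof -
      have "E s x = C (Suc (N s)) s x" using E[of "Suc (N s)" s x] N[of s] that by simp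
      also have "\<dots> = G s x + (s - k) / w * tent_integral w (C (N s)) s x"
        by (simp add: C_def)
      also have "tent_integral w (C (N s)) s x = tent_integral w E s x"
        using that N[of s] by (intro tent_integral_cong) (subst E[of "N s"], auto)
      finally show ?thesis .
    qed
  qed
qed

section \<open>The continued Barnes double zeta function\<close>

text \<open>Integration by parts: the derivative of \<open>A\<close> below is \<open>- s\<close>
  times the integrand of \<open>tent_integral\<close>. Differentiating the factor
  \<open>w - u\<close> contributes \<open>- pw s (y + u)\<close>, which the second term of
  \<open>A\<close> cancels.\<close>

lemma pw_recursion:
  assumes "s \<noteq> 1" "y > 0" "w > 0"
  shows "pw s y = (pw (s - 1) y - pw (s - 1) (y + w)) / (w * (s - 1)) + s / w * tent_integral w pw s y"
proof -
  define A where "A u = of_real (w - u) * pw s (y + u) - pw (s - 1) (y + u) / (s - 1)" for u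
  have "((\<lambda>u. - s * (of_real (w - u) * pw (s + 1) (y + u))) has_integral (A w - A 0)) {0..w}"
  proof (rule fundamental_theorem_of_calculus)
    fix u assume u: "u \<in> {0..w}"
    hence pos: "y + u > 0" using assms by auto
    have 1: "((\<lambda>u. pw s (y + u)) has_vector_derivative (- s * pw (s + 1) (y + u))) (at u within {0..w})"
      by (rule has_vector_derivative_pw[OF pos])
    have 2: "((\<lambda>u. pw (s - 1) (y + u)) has_vector_derivative (- (s - 1) * pw s (y + u))) (at u within {0..w})"
      using has_vector_derivative_pw[OF pos, of "s - 1"] by simp
    have 3: "((\<lambda>u. complex_of_real (w - u)) has_vector_derivative - 1) (at u within {0..w})"
      unfolding of_real_diff by (auto intro!: derivative_eq_intros)
    show "(A has_vector_derivative - s * (of_real (w - u) * pw (s + 1) (y + u))) (at u within {0..w})"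
      unfolding A_def
      by (rule has_vector_derivative_eq_rhs[OF has_vector_derivative_diff[OF has_vector_derivative_mult[OF 3 1] has_vector_derivative_divide[OF 2, of "s - 1"]]])
         (use assms(1) in \<open>simp add: field_simps\<close>)
  qed (use assms in auto)
  hence "- s * tent_integral w pw s y = A w - A 0"
    unfolding tent_integral_def by (subst integral_mult_right[symmetric]) (rule integral_unique)
  also have "A w - A 0 = - (w * pw s y) + (pw (s - 1) y - pw (s - 1) (y + w)) / (s - 1)"
    by (simp add: A_def diff_divide_distrib)
  finally have "- (- s * tent_integral w pw s y) = - (- (w * pw s y) + (pw (s - 1) y - pw (s - 1) (y + w)) / (s - 1))"
    by (rule arg_cong)
  hence e: "s * tent_integral w pw s y = w * pw s y - (pw (s - 1) y - pw (s - 1) (y + w)) / (s - 1)"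
    by simp
  have "s / w * tent_integral w pw s y = pw s y - (pw (s - 1) y - pw (s - 1) (y + w)) / (w * (s - 1))"
    using assms(3) arg_cong[OF e, of "\<lambda>z. z / of_real w"] by (simp add: diff_divide_distrib mult.commute)
  thus ?thesis by simp
qed

text \<open>Termwise integration under uniform convergence. The half-plane is
  \<open>Re s > c\<close>, one unit larger than that of the lattice sum, as the integrand is taken
  at \<open>s + 1\<close>; this is what later makes the sum over \<open>m\<close> converge for
  \<open>Re s > 1\<close>.\<close>

lemma tent_integral_lattice_sums:
  assumes "regular c f" "decaying c f" "v > 0" "w > 0" "Re s > c" "x > 0"
  shows "(\<lambda>m. tent_integral w f s (x + v * real m)) sums tent_integral w (lattice_sum v f) s x"
proof -
  define h where "h m u = of_real (w - u) * f (s + 1) (x + u + v * real m)" for m u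
  have "c < Re s + 1" using assms by simp
  then obtain C where "C \<ge> 0" and C: "\<And>z y n. Re s + 1 \<le> Re z \<Longrightarrow> Re z \<le> Re s + 1 \<Longrightarrow> x \<le> y \<Longrightarrow>
       norm (f z (y + v * real n)) \<le> C * (y + v * real n) powr (-(Re s + 1 - c))"
    using decaying_shiftE[OF assms(2) _ assms(6,3), of "Re s + 1" "Re s + 1"] by blast
  have pos: "x + v * real m > 0" for m using assms by (simp add: add_pos_nonneg)
  have ul: "uniform_limit {0..w} (\<lambda>N u. \<Sum>m<N. h m u) (\<lambda>u. \<Sum>m. h m u) sequentially"
  proof (rule Weierstrass_m_test)
    show "summable (\<lambda>m. w * (C * (x + v * real m) powr (-(Re s + 1 - c))))"
      using assms by (intro summable_mult summable_powr_lattice) auto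
    fix m u assume u: "u \<in> {0..w}"
    have "norm (f (s + 1) (x + u + v * real m)) \<le> C * (x + u + v * real m) powr (-(Re s + 1 - c))"
      using C[of "s + 1" "x + u" m] u by simp
    also have "\<dots> \<le> C * (x + v * real m) powr (-(Re s + 1 - c))"
      using u pos[of m] \<open>C \<ge> 0\<close> assms by (intro mult_left_mono powr_mono2') auto
    finally have 1: "norm (f (s + 1) (x + u + v * real m)) \<le> C * (x + v * real m) powr (-(Re s + 1 - c))" .
    have "norm (h m u) = (w - u) * norm (f (s + 1) (x + u + v * real m))"
      using u unfolding h_def norm_mult norm_of_real by simp
    also have "\<dots> \<le> w * (C * (x + v * real m) powr (-(Re s + 1 - c)))"
      using u 1 by (intro mult_mono) auto
    finally show "norm (h m u) \<le> w * (C * (x + v * real m) powr (-(Re s + 1 - c)))" .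
  qed
  have ch: "continuous_on {0..w} (h m)" for m
  proof -
    have "continuous_on {0..w} (\<lambda>u. f (s + 1) (x + u + v * real m))"
    proof (rule regular_continuous_on[OF assms(1)])
      show "x + u + v * real m > 0" if "u \<in> {0..w}" for u
        using pos[of m] that by simp
    qed (use assms in \<open>auto intro!: continuous_intros\<close>)
    thus ?thesis unfolding h_def by (intro continuous_intros)
  qed
  have cs: "continuous_on {0..w} (\<lambda>u. \<Sum>m<N. h m u)" for N
    by (intro continuous_intros ch)
  obtain I J where I: "\<And>N. ((\<lambda>u. \<Sum>m<N. h m u) has_integral I N) {0..w}"
    and J: "((\<lambda>u. \<Sum>m. h m u) has_integral J) {0..w}" and IJ: "I \<longlonglongrightarrow> J"
    using uniform_limit_integral[OF ul cs] by auto
  have "I N = (\<Sum>m<N. tent_integral w f s (x + v * real m))" for N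
  proof -
    have "I N = (\<Sum>m<N. integral {0..w} (h m))"
      using I[of N] ch by (subst integral_sum[symmetric]) (auto intro!: integrable_continuous_real simp: integral_unique)
    moreover have "h m = (\<lambda>u. of_real (w - u) * f (s + 1) (x + v * real m + u))" for m
      unfolding h_def by (simp only: add.assoc add.commute[of "v * real m"])
    ultimately show ?thesis by (simp only: tent_integral_def)
  qed
  moreover have "J = tent_integral w (lattice_sum v f) s x"
  proof -
    have "(\<Sum>m. h m u) = of_real (w - u) * lattice_sum v f (s + 1) (x + u)" if u: "u \<in> {0..w}" for u
    proof -
      have "summable (\<lambda>m. f (s + 1) (x + u + v * real m))"
        by (rule summable_norm_cancel, rule summable_lattice_sum[OF assms(3,2)]) (use assms u in auto)
      thus ?thesis unfolding h_def lattice_sum_def by (rule suminf_mult)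
    qed
    thus ?thesis using J unfolding tent_integral_def
      by (subst integral_cong[of _ _ "\<lambda>u. \<Sum>m. h m u"]) (auto simp: integral_unique)
  qed
  ultimately show ?thesis using IJ unfolding sums_def by presburger
qed

text \<open>The identity for a single power is summed over the progression: its differences
  telescope to \<open>pw (s - 1) x\<close>, the powers tending to zero at infinity because
  \<open>Re s > 1\<close>.\<close>

lemma hurwitz_recursion:
  assumes "w > 0" "Re s > 1" "x > 0"
  shows "lattice_sum w pw s x = pw (s - 1) x / (w * (s - 1)) + s / w * tent_integral w (lattice_sum w pw) s x"
proof -
  have s: "s \<noteq> 1" using assms by auto
  have pos: "x + w * real n > 0" for n using assms by (simp add: add_pos_nonneg)
  have lim: "(\<lambda>n. pw (s - 1) (x + w * real n)) \<longlonglongrightarrow> 0"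
  proof (rule tendsto_norm_zero_cancel)
    have "filterlim (\<lambda>n. x + w * real n) at_top sequentially"
      using assms by (intro filterlim_tendsto_add_at_top[OF tendsto_const]
        filterlim_tendsto_pos_mult_at_top[OF tendsto_const _ filterlim_real_sequentially])
    hence "(\<lambda>n. (x + w * real n) powr (-(Re s - 1))) \<longlonglongrightarrow> 0"
      using assms by (intro tendsto_neg_powr) auto
    thus "(\<lambda>n. norm (pw (s - 1) (x + w * real n))) \<longlonglongrightarrow> 0"
      by (simp add: norm_pw[OF pos])
  qed
  have "(\<lambda>n. pw (s - 1) (x + w * real n) - pw (s - 1) (x + w * real (Suc n))) sums (pw (s - 1) (x + w * real 0) - 0)"
    by (rule telescope_sums'[OF lim])
  hence "(\<lambda>n. (pw (s - 1) (x + w * real n) - pw (s - 1) (x + w * real n + w)) / (w * (s - 1))) sums (pw (s - 1) x / (w * (s - 1)))"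
    using sums_divide by (simp add: algebra_simps)
  moreover have "(\<lambda>n. s / w * tent_integral w pw s (x + w * real n)) sums (s / w * tent_integral w (lattice_sum w pw) s x)"
    using assms by (intro sums_mult tent_integral_lattice_sums[OF regular_pw[of 0] decaying_pw]) auto
  ultimately have "(\<lambda>n. (pw (s - 1) (x + w * real n) - pw (s - 1) (x + w * real n + w)) / (w * (s - 1)) +
      s / w * tent_integral w pw s (x + w * real n)) sums
      (pw (s - 1) x / (w * (s - 1)) + s / w * tent_integral w (lattice_sum w pw) s x)"
    by (rule sums_add)
  hence "(\<lambda>n. pw s (x + w * real n)) sums
      (pw (s - 1) x / (w * (s - 1)) + s / w * tent_integral w (lattice_sum w pw) s x)"
    by (simp only: pw_recursion[OF s pos assms(1), symmetric])
  thus ?thesis unfolding lattice_sum_def[of w pw s x] by (rule sums_unique[symmetric])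
qed

text \<open>Lifts a recursion from \<open>f\<close> to its lattice sum. Convergence of the series of
  \<open>g\<close> at \<open>s - 1\<close> comes out of the argument, since its terms are
  \<open>w (s - 1)\<close> times the difference of the terms of two convergent series.\<close>

lemma lattice_sum_recursion:
  assumes "regular c f" "decaying c f" "v > 0" "w > 0" "c \<ge> 0" "Re s > c + 1" "x > 0"
    and rec: "\<And>x. x > 0 \<Longrightarrow> f s x = g (s - 1) x / (w * (s - 1)) + s / w * tent_integral w f s x"
  shows "lattice_sum v f s x = lattice_sum v g (s - 1) x / (w * (s - 1)) + s / w * tent_integral w (lattice_sum v f) s x"
proof -
  have s: "w * (s - 1) \<noteq> 0" using assms by auto
  have pos: "x + v * real n > 0" for n using assms by (simp add: add_pos_nonneg)
  have 1: "(\<lambda>m. s / w * tent_integral w f s (x + v * real m)) sums (s / w * tent_integral w (lattice_sum v f) s x)"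
    using assms by (intro sums_mult tent_integral_lattice_sums[OF assms(1,2)]) auto
  have 2: "(\<lambda>m. f s (x + v * real m)) sums lattice_sum v f s x"
    unfolding lattice_sum_def using assms
    by (intro summable_sums summable_norm_cancel[OF summable_lattice_sum[of v c f s x]])
  have "(\<lambda>m. w * (s - 1) * (f s (x + v * real m) - s / w * tent_integral w f s (x + v * real m))) sums
      (w * (s - 1) * (lattice_sum v f s x - s / w * tent_integral w (lattice_sum v f) s x))"
    by (intro sums_mult sums_diff 1 2)
  hence "(\<lambda>m. g (s - 1) (x + v * real m)) sums
      (w * (s - 1) * (lattice_sum v f s x - s / w * tent_integral w (lattice_sum v f) s x))"
    using s by (simp add: rec[OF pos])
  hence "lattice_sum v g (s - 1) x = w * (s - 1) * (lattice_sum v f s x - s / w * tent_integral w (lattice_sum v f) s x)"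
    unfolding lattice_sum_def[of v g] by (rule sums_unique[symmetric])
  thus ?thesis using s by simp
qed

section \<open>Clearing the poles: entire forms of the Hurwitz and Barnes functions\<close>

lemma regular_shift:
  assumes "regular c f"
  shows "regular (c + 1) (\<lambda>s x. f (s - 1) x)"
proof -
  have 1: "continuous_on ({s. Re s > c} \<times> {0<..}) (\<lambda>(s, x). f s x)"
    using assms unfolding regular_def by blast
  have 2: "continuous_on ({s. Re s > c + 1} \<times> {0<..}) (\<lambda>p. (fst p - 1, snd p))"
    by (intro continuous_intros)
  have 3: "(\<lambda>p. (fst p - 1, snd p)) ` ({s. Re s > c + 1} \<times> {0<..}) \<subseteq> {s. Re s > c} \<times> {0::real<..}"
    by auto
  have "(\<lambda>s. f (s - 1) x) holomorphic_on {s. Re s > c + 1}" if "x > 0" for x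
  proof -
    have "(\<lambda>s. f s x) holomorphic_on {s. Re s > c}"
      using assms that unfolding regular_def by blast
    hence "(\<lambda>s. f s x) \<circ> (\<lambda>s. s - 1) holomorphic_on {s. Re s > c + 1}"
      by (intro holomorphic_on_compose holomorphic_intros) (auto elim: holomorphic_on_subset)
    thus ?thesis by (simp add: o_def)
  qed
  with continuous_on_compose2[OF 1 2 3] show ?thesis
    unfolding regular_def by (simp add: case_prod_unfold)
qed

lemma regular_divide: "regular c f \<Longrightarrow> regular c (\<lambda>s x. f s x / a)"
  using regular_mult[of "\<lambda>_. inverse a" c f] by (simp add: divide_inverse mult.commute)

lemma tent_integral_cmult:
  "tent_integral w (\<lambda>s x. p s * f s x) s x = p (s + 1) * tent_integral w f s x"
  unfolding tent_integral_def by (simp add: mult.left_commute)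

text \<open>Inside \<open>tent_integral\<close>, which evaluates at \<open>s + 1\<close>, the factor
  \<open>s - 1\<close> becomes \<open>s\<close>. It thus absorbs the \<open>s\<close> of the
  recursion and leaves the coefficient \<open>(s - 1) / w\<close>, which has no pole.\<close>

lemma hurwitz_entire:
  assumes "w > 0"
  shows "\<exists>E. (\<forall>c. regular c E) \<and>
    (\<forall>s x. Re s > 1 \<longrightarrow> x > 0 \<longrightarrow> E s x = (s - 1) * lattice_sum w pw s x) \<and>
    (\<forall>(s::complex) x. x > 0 \<longrightarrow> E s x = pw (s - 1) x / w + (s - 1) / w * tent_integral w E s x)"
proof (rule entire_extension[of 1 "\<lambda>s x. (s - 1) * lattice_sum w pw s x" "\<lambda>s x. pw (s - 1) x / w" w 1])
  show "regular 1 (\<lambda>s x. (s - 1) * lattice_sum w pw s x)"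
    using regular_lattice_sum[OF assms regular_pw[of 0] decaying_pw]
    by (intro regular_mult holomorphic_intros) simp
  show "regular c (\<lambda>s x. pw (s - 1) x / w)" for c
    using regular_shift[OF regular_pw[of "c - 1"]] by (intro regular_divide) simp
  fix s :: complex and x :: real assume sx: "1 < Re s" "0 < x"
  have "s \<noteq> 1" using sx by auto
  thus "(s - 1) * lattice_sum w pw s x = pw (s - 1) x / w + (s - 1) / w * tent_integral w (\<lambda>s x. (s - 1) * lattice_sum w pw s x) s x"
    unfolding tent_integral_cmult[where p = "\<lambda>s. s - 1"] using assms
    by (subst hurwitz_recursion[OF assms sx]) (simp add: field_simps)
qed (rule assms)

abbreviation barnes_sum :: "real \<Rightarrow> real \<Rightarrow> complex \<Rightarrow> real \<Rightarrow> complex" where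
  "barnes_sum v w \<equiv> lattice_sum v (lattice_sum w pw)"

lemma
  assumes "w > 0"
  shows regular_hurwitz: "regular 1 (lattice_sum w pw)" and decaying_hurwitz: "decaying 1 (lattice_sum w pw)"
  using regular_lattice_sum[OF assms regular_pw[of 0] decaying_pw] decaying_lattice_sum[OF assms decaying_pw] by simp_all

text \<open>The same device with \<open>(s - 1) * (s - 2)\<close>, which becomes
  \<open>s * (s - 1)\<close> at \<open>s + 1\<close> and leaves \<open>s - 2\<close>; the
  inhomogeneous term is the entire Hurwitz form of step \<open>v\<close> at \<open>s - 1\<close>.
  The last clause unrolls both recursions once, so that for \<open>Re s > 1\<close> only convergent
  series stand on the right.\<close>

lemma barnes_entire:
  assumes "v > 0" "w > 0"
  shows "\<exists>E. (\<forall>c. regular c E) \<and>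
    (\<forall>s x. Re s > 2 \<longrightarrow> x > 0 \<longrightarrow> E s x = (s - 1) * (s - 2) * barnes_sum v w s x) \<and>
    (\<forall>s x. Re s > 1 \<longrightarrow> x > 0 \<longrightarrow> E s x = pw (s - 2) x / (v * w) +
        (s - 1) * (s - 2) * (tent_integral v (lattice_sum v pw) (s - 1) x / (v * w) + s / w * tent_integral w (barnes_sum v w) s x))"
proof -
  \<comment> \<open>With \<open>a = s - 1\<close> and \<open>b = s - 2\<close>, \<open>alg1\<close>
    is the recursion multiplied by \<open>(s - 1) * (s - 2)\<close>, and \<open>alg2\<close>
    collects the two recursions after unrolling.\<close>
  have alg1: "a * b * (L / (W * a) + s / W * T) = b * L / W + b / W * (s * a * T)"
    if "a \<noteq> 0" "W \<noteq> 0" for a W b L s T :: complex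
    using that by (simp add: field_simps)
  have alg2: "(P / V + b / V * (a * T)) / W + b / W * (s * a * T') = P / (V * W) + a * b * (T / (V * W) + s / W * T')"
    if "V \<noteq> 0" "W \<noteq> 0" for V W P b a T s T' :: complex
    using that by (simp add: field_simps)
  obtain E1 where E1: "\<forall>c. regular c E1"
    "\<forall>s x. Re s > 1 \<longrightarrow> x > 0 \<longrightarrow> E1 s x = (s - 1) * lattice_sum v pw s x"
    "\<forall>(s::complex) x. x > 0 \<longrightarrow> E1 s x = pw (s - 1) x / v + (s - 1) / v * tent_integral v E1 s x"
    using hurwitz_entire[OF assms(1)] by (elim exE conjE) (rule that)
  note E1 = E1[rule_format]
  have "\<exists>E. (\<forall>c. regular c E) \<and>
    (\<forall>s x. Re s > 2 \<longrightarrow> x > 0 \<longrightarrow> E s x = (s - 1) * (s - 2) * barnes_sum v w s x) \<and>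
    (\<forall>(s::complex) x. x > 0 \<longrightarrow> E s x = E1 (s - 1) x / w + (s - 2) / w * tent_integral w E s x)"
  proof (rule entire_extension[of 2 "\<lambda>s x. (s - 1) * (s - 2) * barnes_sum v w s x" "\<lambda>s x. E1 (s - 1) x / w" w 2])
    show "regular 2 (\<lambda>s x. (s - 1) * (s - 2) * barnes_sum v w s x)"
      using regular_lattice_sum[OF assms(1) regular_hurwitz decaying_hurwitz] assms
      by (intro regular_mult holomorphic_intros) simp
    show "regular c (\<lambda>s x. E1 (s - 1) x / w)" for c
      using regular_shift[OF E1(1)[of "c - 1"]] by (intro regular_divide) simp
    fix s :: complex and x :: real assume sx: "2 < Re s" "0 < x"
    have "s \<noteq> 1" "s \<noteq> 2" using sx by auto
    moreover have "barnes_sum v w s x = lattice_sum v pw (s - 1) x / (w * (s - 1)) + s / w * tent_integral w (barnes_sum v w) s x"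
      by (rule lattice_sum_recursion[OF regular_hurwitz decaying_hurwitz assms])
         (use sx assms hurwitz_recursion[OF assms(2), of s] in auto)
    moreover have "E1 (s - 1) x = (s - 2) * lattice_sum v pw (s - 1) x"
      using E1(2)[of "s - 1" x] sx by (simp add: algebra_simps)
    ultimately show "(s - 1) * (s - 2) * barnes_sum v w s x = E1 (s - 1) x / w +
        (s - 2) / w * tent_integral w (\<lambda>s x. (s - 1) * (s - 2) * barnes_sum v w s x) s x"
      unfolding tent_integral_cmult[where p = "\<lambda>s. (s - 1) * (s - 2)"] 
      using alg1[of "s - 1" "complex_of_real w" "s - 2" "lattice_sum v pw (s - 1) x" s "tent_integral w (barnes_sum v w) s x"] assms
      by simp
  qed (rule assms)
  then obtain E where E: "\<forall>c. regular c E"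
    "\<forall>s x. Re s > 2 \<longrightarrow> x > 0 \<longrightarrow> E s x = (s - 1) * (s - 2) * barnes_sum v w s x"
    "\<forall>(s::complex) x. x > 0 \<longrightarrow> E s x = E1 (s - 1) x / w + (s - 2) / w * tent_integral w E s x"
    by (elim exE conjE) (rule that)
  note E = E[rule_format]
  show ?thesis
  proof (intro exI[of _ E] conjI allI impI E(1,2))
    fix s :: complex and x :: real assume sx: "1 < Re s" "0 < x"
    have "tent_integral w E s x = tent_integral w (\<lambda>s x. (s - 1) * (s - 2) * barnes_sum v w s x) s x"
      using sx by (intro tent_integral_cong E(2)) auto
    hence 1: "tent_integral w E s x = s * (s - 1) * tent_integral w (barnes_sum v w) s x"
      unfolding tent_integral_cmult[where p = "\<lambda>s. (s - 1) * (s - 2)"] by simp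
    have "tent_integral v E1 (s - 1) x = tent_integral v (\<lambda>s x. (s - 1) * lattice_sum v pw s x) (s - 1) x"
      using sx by (intro tent_integral_cong E1(2)) auto
    hence 2: "tent_integral v E1 (s - 1) x = (s - 1) * tent_integral v (lattice_sum v pw) (s - 1) x"
      unfolding tent_integral_cmult[where p = "\<lambda>s. s - 1"] by simp
    have "E s x = (pw (s - 1 - 1) x / v + (s - 1 - 1) / v * tent_integral v E1 (s - 1) x) / w + (s - 2) / w * tent_integral w E s x"
      using sx by (subst E(3), simp, subst E1(3)) auto
    thus "E s x = pw (s - 2) x / (v * w) +
        (s - 1) * (s - 2) * (tent_integral v (lattice_sum v pw) (s - 1) x / (v * w) + s / w * tent_integral w (barnes_sum v w) s x)"
      unfolding 1 2 using assms
      alg2[of "complex_of_real v" "complex_of_real w" "pw (s - 2) x" "s - 2" "s - 1" "tent_integral v (lattice_sum v pw) (s - 1) x" s "tent_integral w (barnes_sum v w) s x"]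
      by simp
  qed
qed

text \<open>A meromorphic difference either vanishes or avoids zero outside a sparse set, so
  agreement on an open set spreads to a punctured neighbourhood of every point. The prescribed value
  at poles, and continuity elsewhere, then settle the value at the point itself.\<close>

lemma nicely_meromorphic_eqI:
  assumes "f nicely_meromorphic_on UNIV" "g nicely_meromorphic_on UNIV"
    and U: "open U" "U \<noteq> {}" "\<And>z. z \<in> U \<Longrightarrow> f z = g z"
  shows "f = g"
proof
  fix z
  have mer: "(\<lambda>z. f z - g z) meromorphic_on UNIV"
    using assms unfolding nicely_meromorphic_on_def by (intro meromorphic_intros) auto
  have "(\<forall>\<^sub>\<approx>z\<in>UNIV. f z - g z = 0) \<or> (\<forall>\<^sub>\<approx>z\<in>UNIV. f z - g z \<noteq> 0)"
    by (rule meromorphic_imp_constant_or_avoid[OF mer]) auto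
  moreover have False if "\<forall>\<^sub>\<approx>z\<in>UNIV. f z - g z \<noteq> 0"
  proof -
    obtain z0 where z0: "z0 \<in> U" using U by blast
    have "eventually (\<lambda>z. f z - g z \<noteq> 0) (at z0)"
      using that by (simp add: eventually_cosparse_open_eq)
    moreover have "eventually (\<lambda>z. z \<in> U) (at z0)"
      using U(1) z0 by (rule eventually_at_in_open')
    ultimately have "eventually (\<lambda>z. False) (at z0)"
      by eventually_elim (use U in auto)
    thus False by simp
  qed
  ultimately have "\<forall>\<^sub>\<approx>z\<in>UNIV. f z - g z = 0" by blast
  hence ev: "eventually (\<lambda>w. f w = g w) (at z)"
    by (simp add: eventually_cosparse_open_eq)
  have pole: "is_pole f z \<longleftrightarrow> is_pole g z"
    using ev by (intro is_pole_cong) auto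
  have lim: "f \<midarrow>z\<rightarrow> l \<longleftrightarrow> g \<midarrow>z\<rightarrow> l" for l
    using ev by (rule tendsto_cong)
  have f: "(is_pole f z \<and> f z = 0) \<or> f \<midarrow>z\<rightarrow> f z" and g: "(is_pole g z \<and> g z = 0) \<or> g \<midarrow>z\<rightarrow> g z"
    using assms(1,2) unfolding nicely_meromorphic_on_def by auto
  have no: "\<not> (is_pole f z \<and> f \<midarrow>z\<rightarrow> l)" for l
    unfolding is_pole_def using not_tendsto_and_filterlim_at_infinity[of "at z" f l] by auto
  show "f z = g z"
    using f g pole lim no LIM_unique by metis
qed

text \<open>The entire function \<open>E\<close> divided by \<open>(s - 1) * (s - 2)\<close>, in
  normal form, meets the defining description, and uniqueness identifies it with
  \<open>barnes_zeta2\<close>. The formula is then the last clause of \<open>barnes_entire\<close>,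
  with the tent integral taken term by term.\<close>

theorem barnes_zeta2_eq:
  assumes "\<alpha> > 0" "v > 0" "w > 0" and s: "Re s > 1" "s \<noteq> 2"
  shows "barnes_zeta2 \<alpha> v w s = pw (s - 2) \<alpha> / (v * w * (s - 1) * (s - 2)) +
    tent_integral v (lattice_sum v pw) (s - 1) \<alpha> / (v * w) +
    (\<Sum>m. s / w * tent_integral w (lattice_sum w pw) s (\<alpha> + v * real m))"
proof -
  obtain E where E: "\<forall>c. regular c E"
    "\<forall>s x. Re s > 2 \<longrightarrow> x > 0 \<longrightarrow> E s x = (s - 1) * (s - 2) * barnes_sum v w s x"
    "\<forall>s x. Re s > 1 \<longrightarrow> x > 0 \<longrightarrow> E s x = pw (s - 2) x / (v * w) +
        (s - 1) * (s - 2) * (tent_integral v (lattice_sum v pw) (s - 1) x / (v * w) + s / w * tent_integral w (barnes_sum v w) s x)"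
    using barnes_entire[OF assms(2,3)] by (elim exE conjE) (rule that)
  note E = E[rule_format]
  \<comment> \<open>At \<open>1\<close> and \<open>2\<close> division by zero gives the value
    \<open>0\<close>, which may be wrong at a removable singularity; passing to
    \<open>remove_sings Q\<close> corrects this and changes nothing elsewhere.\<close>
  define Q where "Q s = E s \<alpha> / ((s - 1) * (s - 2))" for s
  have "(\<lambda>s. E s \<alpha>) holomorphic_on UNIV"
  proof -
    have "(\<lambda>s. E s \<alpha>) field_differentiable (at z)" for z
    proof -
      have "(\<lambda>s. E s \<alpha>) holomorphic_on {s. Re s > Re z - 1}"
        using E(1)[of "Re z - 1"] assms(1) unfolding regular_def by blast
      thus ?thesis by (rule holomorphic_on_imp_differentiable_at) (auto simp: open_halfspace_Re_gt)
    qed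
    thus ?thesis by (auto simp: holomorphic_on_def)
  qed
  hence an: "(\<lambda>s. E s \<alpha>) analytic_on UNIV" by (simp add: analytic_on_open)
  have Qan: "Q analytic_on {z}" if "z \<noteq> 1" "z \<noteq> 2" for z
    unfolding Q_def using that by (intro analytic_intros analytic_on_subset[OF an]) auto
  have "Q meromorphic_on UNIV"
    unfolding Q_def by (intro meromorphic_intros analytic_on_imp_meromorphic_on[OF an]) 
  hence nice: "remove_sings Q nicely_meromorphic_on UNIV"
    by (rule remove_sings_nicely_meromorphic)
  have rQ: "remove_sings Q z = Q z" if "z \<noteq> 1" "z \<noteq> 2" for z
    using Qan[OF that] by (rule remove_sings_at_analytic)
  have ser: "remove_sings Q z = barnes_zeta2_series \<alpha> v w z" if "Re z > 2" for z
  proof -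
    have "z \<noteq> 1" "z \<noteq> 2" using that by auto
    thus ?thesis unfolding barnes_zeta2_series_eq
      using rQ E(2)[OF that assms(1)] by (simp add: Q_def)
  qed
  have "barnes_zeta2 \<alpha> v w = remove_sings Q"
    unfolding barnes_zeta2_def
  proof (rule the_equality)
    fix Z assume Z: "Z nicely_meromorphic_on UNIV \<and> (\<forall>s. 2 < Re s \<longrightarrow> Z s = barnes_zeta2_series \<alpha> v w s)"
    show "Z = remove_sings Q"
    proof (rule nicely_meromorphic_eqI[OF _ nice, of _ "{s. Re s > 2}"])
      have "(3::complex) \<in> {s. Re s > 2}" by simp
      thus "{s. 2 < Re s} \<noteq> {}" by blast
    qed (use Z ser open_halfspace_Re_gt in auto)
  qed (use nice ser in auto)
  moreover have "s \<noteq> 1" using s by auto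
  ultimately have "barnes_zeta2 \<alpha> v w s = E s \<alpha> / ((s - 1) * (s - 2))"
    using s rQ by (simp add: Q_def)
  also have "\<dots> = pw (s - 2) \<alpha> / (v * w * (s - 1) * (s - 2)) +
      tent_integral v (lattice_sum v pw) (s - 1) \<alpha> / (v * w) + s / w * tent_integral w (barnes_sum v w) s \<alpha>"
    unfolding E(3)[OF s(1) assms(1)] using s \<open>s \<noteq> 1\<close> assms by (simp add: add_divide_distrib mult_ac)
  also have "s / w * tent_integral w (barnes_sum v w) s \<alpha> =
      (\<Sum>m. s / w * tent_integral w (lattice_sum w pw) s (\<alpha> + v * real m))"
    using assms s by (intro sums_unique sums_mult tent_integral_lattice_sums[OF regular_hurwitz decaying_hurwitz]) auto
  finally show ?thesis by (simp only: of_real_mult)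
qed

section \<open>Correlations of powers on a progression\<close>

text \<open>The sum is averaged over \<open>L\<close> shifts, the shift by \<open>l\<close> changing
  it by at most \<open>2 * B * l\<close>. Cauchy-Schwarz applied to the averaged sum leads to
  correlations of pairs of shifts: the diagonal gives at most \<open>B\<^sup>2\<close> for each
  \<open>n\<close>, and for fixed \<open>l\<close> every distance \<open>d\<close> occurs at most
  twice. As \<open>z\<close> is defined on all indices, shifts may run beyond
  \<open>M\<close>.\<close>

lemma van_der_corput_inequality:
  fixes z :: "nat \<Rightarrow> complex" and B :: real
  assumes B: "\<And>n. norm (z n) \<le> B"
    and R: "\<And>l l'. l < l' \<Longrightarrow> l' < L \<Longrightarrow> norm (\<Sum>n<M. z (n + l) * cnj (z (n + l'))) \<le> R (l' - l)"
    and R0: "\<And>d. R d \<ge> 0"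
  shows "real L * norm (\<Sum>n<M. z n) \<le> (real L)\<^sup>2 * B +
    sqrt (real M * (real L * real M * B\<^sup>2 + 2 * real L * (\<Sum>d=1..<L. R d)))"
proof -
  have B0: "B \<ge> 0" using B[of 0] norm_ge_zero order_trans by blast
  define S where "S l = (\<Sum>n<M. z (n + l))" for l
  have shift: "norm (S 0 - S l) \<le> 2 * B * real l" for l
  proof (induction l)
    case (Suc l)
    have "S l - S (Suc l) = (\<Sum>n<M. z (n + l) - z (Suc n + l))"
      by (simp add: S_def sum_subtractf)
    also have "\<dots> = z (0 + l) - z (M + l)"
      by (rule sum_lessThan_telescope')
    finally have "norm (S l - S (Suc l)) \<le> B + B"
      using norm_triangle_ineq4[of "z (0 + l)" "z (M + l)"] B[of "0 + l"] B[of "M + l"] by simp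
    moreover have "norm (S 0 - S (Suc l)) \<le> norm (S 0 - S l) + norm (S l - S (Suc l))"
      using norm_triangle_ineq[of "S 0 - S l" "S l - S (Suc l)"] by simp
    ultimately show ?case using Suc by (simp add: algebra_simps)
  qed simp
  define V where "V n = (\<Sum>l<L. z (n + l))" for n
  define W where "W l l' = (\<Sum>n<M. z (n + l) * cnj (z (n + l')))" for l l'
  have SV: "(\<Sum>l<L. S l) = (\<Sum>n<M. V n)"
    unfolding S_def V_def by (rule sum.swap)
  have "of_nat L * S 0 = (\<Sum>l<L. S 0 - S l) + (\<Sum>n<M. V n)"
    by (simp add: sum_subtractf SV)
  hence "real L * norm (S 0) = norm ((\<Sum>l<L. S 0 - S l) + (\<Sum>n<M. V n))"
    by (metis norm_mult norm_of_nat)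
  also have "\<dots> \<le> norm (\<Sum>l<L. S 0 - S l) + norm (\<Sum>n<M. V n)"
    by (rule norm_triangle_ineq)
  also have "norm (\<Sum>l<L. S 0 - S l) \<le> (real L)\<^sup>2 * B"
  proof -
    have g: "(\<Sum>l<N. 2 * B * real l) \<le> (real N)\<^sup>2 * B" for N
    proof (induction N)
      case (Suc N)
      have "(real (Suc N))\<^sup>2 * B = (real N)\<^sup>2 * B + 2 * B * real N + B"
        by (simp add: power2_eq_square algebra_simps)
      thus ?case using Suc B0 by simp
    qed simp
    have "norm (\<Sum>l<L. S 0 - S l) \<le> (\<Sum>l<L. 2 * B * real l)"
      by (rule sum_norm_le) (rule shift)
    thus ?thesis using g[of L] by simp
  qed
  also have "norm (\<Sum>n<M. V n) \<le> sqrt (real M * (real L * real M * B\<^sup>2 + 2 * real L * (\<Sum>d=1..<L. R d)))"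
  proof (rule real_le_rsqrt)
    have "(norm (\<Sum>n<M. V n))\<^sup>2 \<le> (\<Sum>n<M. 1 * norm (V n))\<^sup>2"
      by (intro power_mono) (use norm_sum[of V "{..<M}"] in auto)
    also have "\<dots> \<le> (\<Sum>n<M. 1\<^sup>2) * (\<Sum>n<M. (norm (V n))\<^sup>2)"
      by (rule Cauchy_Schwarz_ineq_sum)
    also have "\<dots> = real M * (\<Sum>n<M. (norm (V n))\<^sup>2)" by simp
    also have "(\<Sum>n<M. (norm (V n))\<^sup>2) \<le> real L * real M * B\<^sup>2 + 2 * real L * (\<Sum>d=1..<L. R d)"
    proof -
      have "complex_of_real (\<Sum>n<M. (norm (V n))\<^sup>2) = (\<Sum>n<M. V n * cnj (V n))"
        by (simp only: of_real_sum complex_norm_square[symmetric])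
      also have "\<dots> = (\<Sum>n<M. \<Sum>l<L. \<Sum>l'<L. z (n + l) * cnj (z (n + l')))"
        unfolding V_def by (simp only: cnj_sum sum_product)
      also have "\<dots> = (\<Sum>l<L. \<Sum>n<M. \<Sum>l'<L. z (n + l) * cnj (z (n + l')))"
        by (rule sum.swap)
      also have "\<dots> = (\<Sum>l<L. \<Sum>l'<L. W l l')"
        unfolding W_def by (intro sum.cong refl sum.swap)
      finally have e: "complex_of_real (\<Sum>n<M. (norm (V n))\<^sup>2) = (\<Sum>l<L. \<Sum>l'<L. W l l')" .
      have "(\<Sum>n<M. (norm (V n))\<^sup>2) = norm (complex_of_real (\<Sum>n<M. (norm (V n))\<^sup>2))"
        unfolding norm_of_real by (simp add: sum_nonneg)
      also have "\<dots> \<le> (\<Sum>l<L. \<Sum>l'<L. norm (W l l'))"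
        unfolding e by (intro sum_norm_le order.refl norm_sum)
      also have "\<dots> \<le> (\<Sum>l<L. real M * B\<^sup>2 + 2 * (\<Sum>d=1..<L. R d))"
      proof (rule sum_mono)
        fix l assume "l \<in> {..<L}" hence l: "l < L" by simp
        have split: "{..<L} = {..<l} \<union> {l} \<union> {l<..<L}" using l by auto
        have "(\<Sum>l'<L. norm (W l l')) = (\<Sum>l'<l. norm (W l l')) + norm (W l l) + (\<Sum>l'\<in>{l<..<L}. norm (W l l'))"
          unfolding split by (subst sum.union_disjoint; (subst sum.union_disjoint)?) auto
        also have "norm (W l l) \<le> real M * B\<^sup>2"
        proof -
          have "norm (W l l) \<le> (\<Sum>n<M. B\<^sup>2)"
            unfolding W_def
          proof (rule sum_norm_le)
            fix n
            have "norm (z (n + l) * cnj (z (n + l))) = (norm (z (n + l)))\<^sup>2"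
              by (simp add: norm_mult power2_eq_square)
            also have "\<dots> \<le> B\<^sup>2" by (intro power_mono B norm_ge_zero)
            finally show "norm (z (n + l) * cnj (z (n + l))) \<le> B\<^sup>2" .
          qed
          thus ?thesis by simp
        qed
        also have "(\<Sum>l'<l. norm (W l l')) \<le> (\<Sum>d=1..<L. R d)"
        proof -
          have "(\<Sum>l'<l. norm (W l l')) \<le> (\<Sum>l'<l. R (l - l'))"
          proof (rule sum_mono)
            fix l' assume "l' \<in> {..<l}"
            have "W l l' = cnj (W l' l)" unfolding W_def by (simp add: mult.commute)
            hence "norm (W l l') = norm (W l' l)" by (simp only: complex_mod_cnj)
            thus "norm (W l l') \<le> R (l - l')" using R[of l' l] l \<open>l' \<in> {..<l}\<close> unfolding W_def by simp
          qed
          also have "\<dots> = sum R ((\<lambda>l'. l - l') ` {..<l})"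
            by (subst sum.reindex) (auto simp: inj_on_def)
          also have "\<dots> \<le> (\<Sum>d=1..<L. R d)"
            using l R0 by (intro sum_mono2) auto
          finally show ?thesis .
        qed
        also have "(\<Sum>l'\<in>{l<..<L}. norm (W l l')) \<le> (\<Sum>d=1..<L. R d)"
        proof -
          have "(\<Sum>l'\<in>{l<..<L}. norm (W l l')) \<le> (\<Sum>l'\<in>{l<..<L}. R (l' - l))"
            by (rule sum_mono) (use R in \<open>auto simp: W_def\<close>)
          also have "\<dots> = sum R ((\<lambda>l'. l' - l) ` {l<..<L})"
            by (subst sum.reindex) (auto simp: inj_on_def)
          also have "\<dots> \<le> (\<Sum>d=1..<L. R d)"
            using l R0 by (intro sum_mono2) auto
          finally show ?thesis .
        qed
        finally show "(\<Sum>l'<L. norm (W l l')) \<le> real M * B\<^sup>2 + 2 * (\<Sum>d=1..<L. R d)" by simp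
      qed
      also have "\<dots> = real L * real M * B\<^sup>2 + 2 * real L * (\<Sum>d=1..<L. R d)"
        by (simp add: algebra_simps)
      finally show ?thesis .
    qed
    finally show "(norm (\<Sum>n<M. V n))\<^sup>2 \<le> real M * (real L * real M * B\<^sup>2 + 2 * real L * (\<Sum>d=1..<L. R d))"
      by (simp add: mult_left_mono)
  qed
  finally show ?thesis by (simp add: S_def)
qed

section \<open>Correlations of powers of exponent \<open>1 + it\<close>\<close>

lemma pw_shift: "x > 0 \<Longrightarrow> pw s x = pw (s + 1) x * of_real x"
  by (simp add: pw_def powr_diff)

lemma cnj_pw: "x > 0 \<Longrightarrow> cnj (pw s x) = pw (cnj s) x"
  unfolding pw_def by (subst cnj_powr) auto

text \<open>The weight \<open>1/y\<close> makes the product \<open>G\<close> of the two powers an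
  exact derivative: \<open>h\<close>, which is ((a + y) / (b + y))^(-it), has derivative
  \<open>q * G\<close>, the factor \<open>b - a\<close> in \<open>q\<close> arising from
  \<open>(a + y) - (b + y)\<close>. Since \<open>h\<close> has modulus one, the integral of
  \<open>G\<close> is at most 2 / |q|; the second summand is the cost of replacing the integral by
  the sum.\<close>

lemma correlation_bound:
  fixes t :: real
  assumes t: "t \<noteq> 0" and w: "w > 0" and ab: "0 \<le> a" "a < b" and y0: "y0 > 0"
  shows "norm (\<Sum>n<M. pw (1 + \<i> * t) (a + (y0 + w * real n)) * cnj (pw (1 + \<i> * t) (b + (y0 + w * real n)))) \<le>
    2 / (w * \<bar>t\<bar> * (b - a)) + real M * w * (\<bar>t\<bar> * (b - a) / y0 ^ 4 + 2 / y0 ^ 3)"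
proof -
  define G where "G y = pw (1 + \<i> * t) (a + y) * pw (1 - \<i> * t) (b + y)" for y
  define h where "h y = pw (\<i> * t) (a + y) * pw (- \<i> * t) (b + y)" for y
  define q where "q = - \<i> * t * of_real (b - a)"
  \<comment> \<open>A bound for the derivative of \<open>G\<close> on \<open>y \<ge> y0\<close>: the
    two weights contribute \<open>1 / y0 ^ 3\<close> each, the phase the term with
    \<open>\<bar>t\<bar>\<close>.\<close>
  define \<kappa> where "\<kappa> = \<bar>t\<bar> * (b - a) / y0 ^ 4 + 2 / y0 ^ 3"
  have q: "q \<noteq> 0" "norm q = \<bar>t\<bar> * (b - a)"
    using t ab by (auto simp: q_def norm_mult simp del: of_real_diff)
  have \<kappa>0: "\<kappa> \<ge> 0" using ab y0 by (simp add: \<kappa>_def)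
  have h': "(h has_vector_derivative q * G y) (at y within A)" if "y > 0" for y A
  proof -
    have pos: "a + y > 0" "b + y > 0" using that ab by auto
    have "(h has_vector_derivative (pw (\<i> * t) (a + y) * (- (- \<i> * t) * pw (- \<i> * t + 1) (b + y)) +
        - (\<i> * t) * pw (\<i> * t + 1) (a + y) * pw (- \<i> * t) (b + y))) (at y within A)"
      unfolding h_def by (intro has_vector_derivative_mult has_vector_derivative_pw pos)
    moreover have "pw (\<i> * t) (a + y) * (- (- \<i> * t) * pw (- \<i> * t + 1) (b + y)) +
        - (\<i> * t) * pw (\<i> * t + 1) (a + y) * pw (- \<i> * t) (b + y) = q * G y"
      unfolding G_def q_def pw_shift[OF pos(1), of "\<i> * t"] pw_shift[OF pos(2), of "- \<i> * t"]
      by (simp add: algebra_simps)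
    ultimately show ?thesis by simp
  qed
  have G': "\<exists>D. (G has_vector_derivative D) (at y within A) \<and> norm D \<le> \<kappa>" if "y \<ge> y0" for y A
  proof -
    have pos: "a + y > 0" "b + y > 0" using that ab y0 by auto
    define D where "D = pw (1 + \<i> * t) (a + y) * (- (1 - \<i> * t) * pw (1 - \<i> * t + 1) (b + y)) +
        - (1 + \<i> * t) * pw (1 + \<i> * t + 1) (a + y) * pw (1 - \<i> * t) (b + y)"
    have 1: "(G has_vector_derivative D) (at y within A)"
      unfolding G_def D_def by (intro has_vector_derivative_mult has_vector_derivative_pw pos)
    have "D = - (pw (2 + \<i> * t) (a + y) * pw (2 - \<i> * t) (b + y)) *
        (of_real (a + y) + of_real (b + y) + \<i> * t * of_real (b - a))"
      unfolding D_def pw_shift[OF pos(1), of "1 + \<i> * t"] pw_shift[OF pos(2), of "1 - \<i> * t"]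
      by (simp add: algebra_simps)
    hence "norm D = norm (pw (2 + \<i> * t) (a + y)) * norm (pw (2 - \<i> * t) (b + y)) *
        norm (of_real (a + y) + of_real (b + y) + \<i> * t * of_real (b - a))"
      by (simp add: norm_mult)
    also have "norm (of_real (a + y) + of_real (b + y) + \<i> * t * of_real (b - a)) \<le> (a + y) + (b + y) + \<bar>t\<bar> * (b - a)"
    proof (intro norm_triangle_le add_mono)
      show "norm (complex_of_real (a + y)) \<le> a + y" using pos by (simp del: of_real_add)
      show "norm (complex_of_real (b + y)) \<le> b + y" using pos by (simp del: of_real_add)
      show "norm (\<i> * t * of_real (b - a)) \<le> \<bar>t\<bar> * (b - a)"
        using ab by (simp add: norm_mult del: of_real_diff)
    qed
    also have "norm (pw (2 + \<i> * t) (a + y)) = 1 / (a + y)\<^sup>2"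
      using pos powr_minus[of "a + y" 2] by (simp add: norm_pw inverse_eq_divide)
    also have "norm (pw (2 - \<i> * t) (b + y)) = 1 / (b + y)\<^sup>2"
      using pos powr_minus[of "b + y" 2] by (simp add: norm_pw inverse_eq_divide)
    also have "1 / (a + y)\<^sup>2 * (1 / (b + y)\<^sup>2) * ((a + y) + (b + y) + \<bar>t\<bar> * (b - a)) =
        1 / ((a + y) * (b + y)\<^sup>2) + 1 / ((a + y)\<^sup>2 * (b + y)) + \<bar>t\<bar> * (b - a) / ((a + y)\<^sup>2 * (b + y)\<^sup>2)"
    proof -
      have "1 / p\<^sup>2 * (1 / q\<^sup>2) * (p + q + e) = 1 / (p * q\<^sup>2) + 1 / (p\<^sup>2 * q) + e / (p\<^sup>2 * q\<^sup>2)"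
        if "p > 0" "q > 0" for p q e :: real
        using that by (simp add: field_simps power2_eq_square)
      from this[OF pos] show ?thesis .
    qed
    also have "\<dots> \<le> 1 / y0 ^ 3 + 1 / y0 ^ 3 + \<bar>t\<bar> * (b - a) / y0 ^ 4"
    proof (intro add_mono divide_left_mono)
      have ya: "y0 \<le> a + y" and yb: "y0 \<le> b + y" using that ab by auto
      have "y0 * y0\<^sup>2 \<le> (a + y) * (b + y)\<^sup>2"
        using ya yb y0 by (intro mult_mono power_mono) auto
      thus "y0 ^ 3 \<le> (a + y) * (b + y)\<^sup>2" by (simp add: power3_eq_cube power2_eq_square)
      have "y0\<^sup>2 * y0 \<le> (a + y)\<^sup>2 * (b + y)"
        using ya yb y0 by (intro mult_mono power_mono) auto
      thus "y0 ^ 3 \<le> (a + y)\<^sup>2 * (b + y)" by (simp add: power3_eq_cube power2_eq_square mult.assoc)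
      have "y0\<^sup>2 * y0\<^sup>2 \<le> (a + y)\<^sup>2 * (b + y)\<^sup>2"
        using ya yb y0 by (intro mult_mono power_mono) auto
      thus "y0 ^ 4 \<le> (a + y)\<^sup>2 * (b + y)\<^sup>2" by (simp add: power_add[symmetric])
    qed (use pos y0 ab in auto)
    also have "\<dots> = \<kappa>" by (simp add: \<kappa>_def)
    finally have "norm D \<le> \<kappa>" by (simp add: mult_left_mono)
    thus ?thesis using 1 by blast
  qed
  have Gdiff: "norm (G (y + u) - G y) \<le> \<kappa> * u" if "y \<ge> y0" "u \<ge> 0" for y u
  proof -
    have "\<exists>D. \<forall>v\<in>{0..u}. ((\<lambda>v. G (y + v)) has_vector_derivative D v) (at v within {0..u}) \<and> norm (D v) \<le> \<kappa>"
    proof (rule bchoice, rule ballI)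
      fix v assume v: "v \<in> {0..u}"
      have "y + v \<ge> y0" using v that by simp
      from G'[OF this, of UNIV] obtain D where D: "(G has_vector_derivative D) (at (y + v))" "norm D \<le> \<kappa>" by blast
      have "((\<lambda>v. y + v) has_vector_derivative 1) (at v within {0..u})"
        by (auto intro!: derivative_eq_intros)
      from vector_diff_chain_within[OF this has_vector_derivative_at_within[OF D(1)]]
      have "((\<lambda>v. G (y + v)) has_vector_derivative D) (at v within {0..u})"
        by (simp add: o_def)
      thus "\<exists>D. ((\<lambda>v. G (y + v)) has_vector_derivative D) (at v within {0..u}) \<and> norm D \<le> \<kappa>"
        using D(2) by blast
    qed
    then obtain D where D: "\<forall>v\<in>{0..u}. ((\<lambda>v. G (y + v)) has_vector_derivative D v) (at v within {0..u}) \<and> norm (D v) \<le> \<kappa>"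
      by blast
    have "norm ((\<lambda>v. G (y + v)) u - (\<lambda>v. G (y + v)) 0) \<le> \<kappa> * u"
      by (rule norm_diff_le_of_vector_derivative[OF that(2), where f' = D]) (use D in auto)
    thus ?thesis by simp
  qed
  \<comment> \<open>The error of the left-endpoint rule on one step: the integral of
    \<open>G\<close> over it is the increment of \<open>h\<close> divided by \<open>q\<close>, and
    \<open>G\<close> varies by at most \<open>\<kappa> * w\<close> there.\<close>
  have step: "norm ((h (y + w) - h y) / q - w * G y) \<le> \<kappa> * w * w" if "y \<ge> y0" for y
  proof -
    define \<phi> where "\<phi> u = h (y + u) / q - of_real u * G y" for u
    have "norm (\<phi> w - \<phi> 0) \<le> \<kappa> * w * w"
    proof (rule norm_diff_le_of_vector_derivative[where f' = "\<lambda>u. G (y + u) - G y"])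
      fix u assume u: "u \<in> {0..w}"
      have "y + u > 0" using u that y0 by simp
      have "((\<lambda>v. y + v) has_vector_derivative 1) (at u within {0..w})"
        by (auto intro!: derivative_eq_intros)
      from vector_diff_chain_within[OF this h'[OF \<open>y + u > 0\<close>]]
      have 1: "((\<lambda>v. h (y + v)) has_vector_derivative q * G (y + u)) (at u within {0..w})"
        by (simp add: o_def)
      have 2: "((\<lambda>v. complex_of_real v) has_vector_derivative 1) (at u within {0..w})"
        by (auto intro!: derivative_eq_intros)
      show "(\<phi> has_vector_derivative G (y + u) - G y) (at u within {0..w})"
        unfolding \<phi>_def
        by (rule has_vector_derivative_eq_rhs[OF has_vector_derivative_diff[OF
              has_vector_derivative_divide[OF 1, of q] has_vector_derivative_mult_left[OF 2, of "G y"]]])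
           (use q in simp)
      have "norm (G (y + u) - G y) \<le> \<kappa> * u" using Gdiff[OF that, of u] u by simp
      also have "\<dots> \<le> \<kappa> * w" using u \<kappa>0 by (intro mult_left_mono) auto
      finally show "norm (G (y + u) - G y) \<le> \<kappa> * w" .
    qed (use w in auto)
    moreover have "\<phi> w - \<phi> 0 = (h (y + w) - h y) / q - w * G y"
      by (simp add: \<phi>_def diff_divide_distrib)
    ultimately show ?thesis by simp
  qed
  have normh: "norm (h y) = 1" if "y > 0" for y
    using that ab by (simp add: h_def norm_mult norm_pw)
  define Y where "Y n = y0 + w * real n" for n
  have Y: "Y n \<ge> y0" "Y n > 0" for n using w y0 by (auto simp: Y_def add_pos_nonneg)
  have "w * (\<Sum>n<M. G (Y n)) = (h (Y M) - h (Y 0)) / q - (\<Sum>n<M. (h (Y n + w) - h (Y n)) / q - w * G (Y n))"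
  proof -
    have "(\<Sum>n<M. (h (Y n + w) - h (Y n)) / q) = (\<Sum>n<M. (h (Y (Suc n)) - h (Y n)) / q)"
      by (simp add: Y_def algebra_simps)
    also have "\<dots> = (h (Y M) - h (Y 0)) / q"
      using sum_lessThan_telescope[of "\<lambda>n. h (Y n)" M] by (simp only: sum_divide_distrib[symmetric])
    finally show ?thesis by (simp add: sum_subtractf sum_distrib_left)
  qed
  also have "norm \<dots> \<le> norm ((h (Y M) - h (Y 0)) / q) + norm (\<Sum>n<M. (h (Y n + w) - h (Y n)) / q - w * G (Y n))"
    by (rule norm_triangle_ineq4)
  also have "norm ((h (Y M) - h (Y 0)) / q) \<le> 2 / (\<bar>t\<bar> * (b - a))"
    unfolding norm_divide q using norm_triangle_ineq4[of "h (Y M)" "h (Y 0)"] normh[OF Y(2)] ab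
    by (intro divide_right_mono) auto
  also have "norm (\<Sum>n<M. (h (Y n + w) - h (Y n)) / q - w * G (Y n)) \<le> (\<Sum>n<M. \<kappa> * w * w)"
    by (rule sum_norm_le) (rule step[OF Y(1)])
  finally have "w * norm (\<Sum>n<M. G (Y n)) \<le> 2 / (\<bar>t\<bar> * (b - a)) + real M * (\<kappa> * w * w)"
    using w by (simp add: norm_mult)
  hence "norm (\<Sum>n<M. G (Y n)) \<le> (2 / (\<bar>t\<bar> * (b - a)) + real M * (\<kappa> * w * w)) / w"
    using w by (simp add: pos_le_divide_eq mult.commute)
  also have "\<dots> = 2 / (w * \<bar>t\<bar> * (b - a)) + real M * w * \<kappa>"
    using w by (simp add: add_divide_distrib mult_ac)
  also have "(\<Sum>n<M. G (Y n)) = (\<Sum>n<M. pw (1 + \<i> * t) (a + (y0 + w * real n)) * cnj (pw (1 + \<i> * t) (b + (y0 + w * real n))))"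
  proof (rule sum.cong)
    fix n
    have "b + Y n > 0" using Y(2)[of n] ab by simp
    from cnj_pw[OF this, of "1 + \<i> * t"]
    show "G (Y n) = pw (1 + \<i> * t) (a + (y0 + w * real n)) * cnj (pw (1 + \<i> * t) (b + (y0 + w * real n)))"
      by (simp add: G_def Y_def)
  qed simp
  finally show ?thesis by (simp add: \<kappa>_def)
qed

section \<open>Exponential sums over dyadic blocks\<close>

text \<open>Integral comparison, from \<open>ln z \<le> z - 1\<close> at
  \<open>z = y / (y + v)\<close>. It is the source of both logarithms in the final estimate: one
  from the sum over the shift distances \<open>d\<close>, one from the sum over
  \<open>m\<close>.\<close>

lemma sum_inverse_le_ln:
  assumes "a > 0" "v > 0"
  shows "(\<Sum>m<N. 1 / (a + v * real m)) \<le> 1 / a + (ln (a + v * real N) - ln a) / v"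
proof -
  have pos: "a + v * real m > 0" for m using assms by (simp add: add_pos_nonneg)
  have step: "1 / (y + v) \<le> (ln (y + v) - ln y) / v" if "y > 0" for y
  proof -
    have "ln (y / (y + v)) \<le> y / (y + v) - 1"
      using that assms by (intro ln_le_minus_one) auto
    moreover have "ln (y / (y + v)) = ln y - ln (y + v)"
      using that assms by (simp add: ln_div)
    moreover have "y / (y + v) - 1 = - (v / (y + v))"
      using that assms by (simp add: field_simps)
    ultimately have "v / (y + v) \<le> ln (y + v) - ln y" by simp
    thus ?thesis using assms by (simp add: field_simps)
  qed
  have "(\<Sum>m<N. 1 / (a + v * real (Suc m))) \<le> (ln (a + v * real N) - ln a) / v"
  proof (induction N)
    case (Suc N)
    have "1 / (a + v * real (Suc N)) \<le> (ln (a + v * real (Suc N)) - ln (a + v * real N)) / v"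
      using step[OF pos[of N]] by (simp add: algebra_simps)
    thus ?case using Suc by (simp add: diff_divide_distrib)
  qed simp
  moreover have "(\<Sum>m<N. 1 / (a + v * real m)) \<le> (\<Sum>m<Suc N. 1 / (a + v * real m))"
    using pos[of N] by simp
  moreover have "(\<Sum>m<Suc N. 1 / (a + v * real m)) = 1 / a + (\<Sum>m<N. 1 / (a + v * real (Suc m)))"
    by (subst sum.lessThan_Suc_shift) simp
  ultimately show ?thesis by linarith
qed

text \<open>Summation by parts: the successive differences of \<open>b\<close> are nonnegative and
  telescope, so only the first weight survives.\<close>

lemma norm_sum_antimono_le:
  fixes a :: "nat \<Rightarrow> complex" and b :: "nat \<Rightarrow> real"
  assumes "\<And>N. N \<le> M \<Longrightarrow> norm (\<Sum>n<N. a n) \<le> A" "\<And>n. b (Suc n) \<le> b n" "\<And>n. b n \<ge> 0"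
  shows "norm (\<Sum>n<M. of_real (b n) * a n) \<le> b 0 * A"
proof -
  define S where "S N = (\<Sum>n<N. a n)" for N
  have abel: "(\<Sum>n<N. of_real (b n) * a n) = of_real (b N) * S N + (\<Sum>n<N. of_real (b n - b (Suc n)) * S (Suc n))" for N
    by (induction N) (simp_all add: S_def algebra_simps)
  have "norm (\<Sum>n<M. of_real (b n) * a n) \<le> norm (of_real (b M) * S M) + norm (\<Sum>n<M. of_real (b n - b (Suc n)) * S (Suc n))"
    unfolding abel by (rule norm_triangle_ineq)
  also have "norm (of_real (b M) * S M) \<le> b M * A"
    using assms(1)[of M] assms(3)[of M] by (simp add: norm_mult S_def mult_left_mono)
  also have "norm (\<Sum>n<M. of_real (b n - b (Suc n)) * S (Suc n)) \<le> (\<Sum>n<M. (b n - b (Suc n)) * A)"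
  proof (rule sum_norm_le)
    fix n assume "n \<in> {..<M}"
    have "norm (of_real (b n - b (Suc n)) * S (Suc n)) = (b n - b (Suc n)) * norm (S (Suc n))"
      using assms(2)[of n] unfolding norm_mult norm_of_real by simp
    also have "\<dots> \<le> (b n - b (Suc n)) * A"
      using assms(1)[of "Suc n"] assms(2)[of n] \<open>n \<in> {..<M}\<close> by (intro mult_left_mono) (auto simp: S_def)
    finally show "norm (of_real (b n - b (Suc n)) * S (Suc n)) \<le> (b n - b (Suc n)) * A" .
  qed
  also have "(\<Sum>n<M. (b n - b (Suc n)) * A) = (b 0 - b M) * A"
    by (simp only: sum_distrib_right[symmetric] sum_lessThan_telescope')
  finally show ?thesis by (simp add: algebra_simps)
qed

text \<open>
  Writing \<open>\<bar>t\<bar> = r\<^sup>1\<^sup>6\<close> keeps all exponents integral: \<open>\<bar>t\<bar>\<^sup>1\<^sup>/\<^sup>2 = r\<^sup>8\<close> and \<open>T = r\<^sup>1\<^sup>8\<close>.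
\<close>

definition block_const :: "real \<Rightarrow> real" where
  "block_const w = 4 + sqrt (1 / w\<^sup>2 + 24 / w ^ 3 + 4 + 4 / w)"

text \<open>Differencing on a block inside [y, 2y], with terms of modulus at most 1/y. With
  \<open>L\<close> shifts the square of the main part is, up to constants, 1/L from the diagonal, y
  / (|t| L) times a logarithm from the boundary terms of the correlations, and |t| L / y^2 + 1/y
  from their discretisation error. Taking L near y / |t|^(1/2) balances the diagonal against |t| L /
  y^2.\<close>

lemma block_bound:
  assumes w: "w > 0" and r: "r \<ge> 1" and t: "\<bar>t\<bar> = r ^ 16"
    and y: "r ^ 8 \<le> y" "y \<le> 2 * r ^ 18" and M: "real M * w \<le> y"
  shows "norm (\<Sum>n<M. pw (1 + \<i> * t) (y + w * real n)) \<le> block_const w * (r ^ 5 * (1 + 16 * ln r)) / sqrt y"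
proof -
  define \<Lambda> where "\<Lambda> = 1 + 16 * ln r"
  have \<Lambda>: "\<Lambda> \<ge> 1" using r by (simp add: \<Lambda>_def)
  have r1: "r ^ k \<ge> 1" for k using r by simp
  have r18: "r ^ 18 = r ^ 10 * r ^ 8" and r16: "r ^ 16 = r ^ 8 * r ^ 8" and r9: "r ^ 9 = r * r ^ 8"
    by (simp_all flip: power_add power_Suc)
  have r8: "r ^ 8 > 0" and rp: "r > 0" using r by auto
  have y0: "y > 0" "y \<ge> 1" using y(1) r1[of 8] by auto
  have t0: "t \<noteq> 0" using t r1[of 16] by auto
  \<comment> \<open>Since \<open>y \<ge> r ^ 8\<close>, the quotient is at least \<open>1\<close>,
    so rounding up at most doubles it.\<close>
  define L where "L = nat \<lceil>y / r ^ 8\<rceil>"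
  have yr: "y / r ^ 8 \<ge> 1" using y(1) r by simp
  have L: "y / r ^ 8 \<le> real L" "real L \<le> 2 * (y / r ^ 8)" "L \<ge> 1" "real L > 0"
    using yr unfolding L_def by linarith+
  define z where "z n = pw (1 + \<i> * t) (y + w * real n)" for n
  have pos: "y + w * real n > 0" for n using y0 w by (simp add: add_pos_nonneg)
  have nz: "norm (z n) \<le> 1 / y" for n
  proof -
    have "norm (z n) = 1 / (y + w * real n)"
      unfolding z_def norm_pw[OF pos] using pos[of n] by (simp add: powr_minus inverse_eq_divide)
    also have "\<dots> \<le> 1 / y" using y0 w pos[of n] by (intro divide_left_mono mult_pos_pos) auto
    finally show ?thesis .
  qed
  define A where "A = 2 / (w\<^sup>2 * \<bar>t\<bar>)"
  define E where "E = w * \<bar>t\<bar> * real L / y ^ 3 + 2 / y\<^sup>2"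
  have AE: "A \<ge> 0" "E \<ge> 0" using w y0 by (auto simp: A_def E_def)
  have corr: "norm (\<Sum>n<M. z (n + l) * cnj (z (n + l'))) \<le> A / real (l' - l) + E"
    if "l < l'" "l' < L" for l l'
  proof -
    have d: "w * real l' - w * real l = w * real (l' - l)"
      using that by (simp add: algebra_simps of_nat_diff)
    have "norm (\<Sum>n<M. z (n + l) * cnj (z (n + l'))) \<le>
        2 / (w * \<bar>t\<bar> * (w * real l' - w * real l)) + real M * w * (\<bar>t\<bar> * (w * real l' - w * real l) / y ^ 4 + 2 / y ^ 3)"
      using correlation_bound[OF t0 w, of "w * real l" "w * real l'" y M] that w y0
      by (simp add: z_def algebra_simps)
    also have "\<dots> = A / real (l' - l) + real M * w * (\<bar>t\<bar> * (w * real (l' - l)) / y ^ 4 + 2 / y ^ 3)"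
      unfolding d A_def by (simp add: power2_eq_square mult_ac)
    also have "real M * w * (\<bar>t\<bar> * (w * real (l' - l)) / y ^ 4 + 2 / y ^ 3) \<le>
        y * (\<bar>t\<bar> * (w * real L) / y ^ 4 + 2 / y ^ 3)"
      using M w y0 that by (intro mult_mono add_right_mono divide_right_mono mult_left_mono) auto
    also have "\<dots> = E"
      using y0 unfolding E_def by (simp add: field_simps power2_eq_square power3_eq_cube power4_eq_xxxx)
    finally show ?thesis by simp
  qed
  \<comment> \<open>From \<open>y \<le> 2 * r ^ 18\<close> one gets
    \<open>L \<le> 4 * r ^ 10\<close>, so the harmonic sum over the shift distances costs one factor
    \<open>\<Lambda>\<close>.\<close>
  have lnL: "1 + ln (real L) \<le> 3 * \<Lambda>"
  proof -
    have "real L \<le> 4 * r ^ 10"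
    proof -
      have "y / r ^ 8 \<le> 2 * r ^ 10"
        using y(2) r unfolding r18 by (simp add: pos_divide_le_eq mult.assoc)
      thus ?thesis using L(2) by linarith
    qed
    hence "ln (real L) \<le> ln (4 * r ^ 10)" using L(4) by (subst ln_le_cancel_iff) (use r in auto)
    also have "\<dots> = 2 * ln 2 + 10 * ln r"
      using r ln_realpow[of 2 2] by (simp add: ln_mult ln_realpow)
    also have "\<dots> \<le> 2 + 16 * ln r" using ln_ge_zero[OF r] ln_2_less_1 by linarith
    finally show ?thesis using ln_ge_zero[OF r] unfolding \<Lambda>_def by argo
  qed
  have sumR: "(\<Sum>d=1..<L. A / real d + E) \<le> A * (3 * \<Lambda>) + real L * E"
  proof -
    have "(\<Sum>d=1..<L. 1 / real d) = (\<Sum>m<L - 1. 1 / (1 + 1 * real m))"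
      by (rule sum.reindex_bij_witness[of _ Suc "\<lambda>d. d - 1"]) auto
    also have "\<dots> \<le> 1 + ln (real L)"
      using sum_inverse_le_ln[of 1 1 "L - 1"] L(3) by (simp add: of_nat_diff)
    finally have "(\<Sum>d=1..<L. 1 / real d) \<le> 3 * \<Lambda>" using lnL by linarith
    hence "A * (\<Sum>d=1..<L. 1 / real d) \<le> A * (3 * \<Lambda>)" using AE(1) by (rule mult_left_mono)
    moreover have "(\<Sum>d=1..<L. A / real d + E) = A * (\<Sum>d=1..<L. 1 / real d) + real (L - 1) * E"
      by (simp add: sum.distrib sum_distrib_left)
    moreover have "real (L - 1) * E \<le> real L * E" using AE by (intro mult_right_mono) auto
    ultimately show ?thesis by linarith
  qed
  define X where "X = real M * (real L * real M * (1 / y)\<^sup>2 + 2 * real L * (\<Sum>d=1..<L. A / real d + E))"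
  have "real L * norm (\<Sum>n<M. z n) \<le> (real L)\<^sup>2 * (1 / y) + sqrt X"
    unfolding X_def
    by (rule van_der_corput_inequality[where R = "\<lambda>d. A / real d + E"]) (use nz corr AE in auto)
  hence 1: "norm (\<Sum>n<M. z n) \<le> real L / y + sqrt X / real L"
    using L(4) by (simp add: field_simps power2_eq_square)
  \<comment> \<open>The summand 1/w^2 comes from the diagonal, 24/w^3 from the harmonic sum, and 4 +
    4/w from \<open>E\<close>. The further 4 in \<open>block_const\<close> pays for the shifts, that
    is, for the term \<open>real L / y\<close>.\<close>
  define C where "C = 1 / w\<^sup>2 + 24 / w ^ 3 + 4 + 4 / w"
  have C0: "C \<ge> 0" using w by (simp add: C_def)
  have Mw: "real M \<le> y / w" using M w by (simp add: field_simps)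
  have iL: "1 / real L \<le> r ^ 8 / y"
    using L(1,4) y0 r8 by (simp add: field_simps)
  have sumR0: "(\<Sum>d=1..<L. A / real d + E) \<ge> 0"
    using AE by (intro sum_nonneg) simp
  have "X / (real L)\<^sup>2 \<le> C * (r ^ 10 * \<Lambda>) / y"
  proof -
    have "X \<le> (y / w) * (real L * (y / w) * (1 / y)\<^sup>2 + 2 * real L * (A * (3 * \<Lambda>) + real L * E))"
      unfolding X_def using Mw sumR sumR0 w y0
      by (intro mult_mono[of "real M"] add_mono mult_left_mono[of _ _ "2 * real L"] mult_right_mono mult_left_mono[of "real M"] add_nonneg_nonneg mult_nonneg_nonneg)
        simp_all
    hence "X / (real L)\<^sup>2 \<le> (y / w) * (real L * (y / w) * (1 / y)\<^sup>2 + 2 * real L * (A * (3 * \<Lambda>) + real L * E)) / (real L)\<^sup>2"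
      by (rule divide_right_mono) simp
    also have "\<dots> = (1 / w\<^sup>2) * (1 / real L) + (6 * A * \<Lambda> / w) * y * (1 / real L) + (2 / w) * (y * E)"
      using L(4) w y0 by (simp add: field_simps power2_eq_square)
    also have "\<dots> \<le> (1 / w\<^sup>2) * (r ^ 10 * \<Lambda> / y) + (24 / w ^ 3) * (r ^ 10 * \<Lambda> / y) + (4 + 4 / w) * (r ^ 10 * \<Lambda> / y)"
    proof (intro add_mono)
      have r810: "r ^ 8 * 1 \<le> r ^ 10 * \<Lambda>"
        using r \<Lambda> by (intro mult_mono power_increasing) auto
      have "r ^ 8 / y \<le> r ^ 10 * \<Lambda> / y" using r810 y0 by (intro divide_right_mono) auto
      thus "(1 / w\<^sup>2) * (1 / real L) \<le> (1 / w\<^sup>2) * (r ^ 10 * \<Lambda> / y)"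
        using iL by (intro mult_left_mono) auto
      have "(6 * A * \<Lambda> / w) * y * (1 / real L) \<le> (6 * A * \<Lambda> / w) * y * (r ^ 8 / y)"
        using iL AE \<Lambda> w y0 by (intro mult_left_mono) auto
      also have "\<dots> = (12 / w ^ 3) * (\<Lambda> / r ^ 8)"
        unfolding A_def t r16 using w y0 r8 by (simp add: field_simps power2_eq_square power3_eq_cube)
      \<comment> \<open>This term decides the exponent: \<open>y \<le> 2 * r ^ 10 * r ^ 8\<close>
        turns 1 / r^8 into r^10 / y, whereas the other terms are of order r^8 / y. The square root
        then gives \<open>r ^ 5\<close>.\<close>
      also have "\<dots> \<le> (12 / w ^ 3) * (2 * (r ^ 10 * \<Lambda> / y))"
      proof (rule mult_left_mono)
        have "\<Lambda> * y \<le> \<Lambda> * (2 * r ^ 18)" using y(2) \<Lambda> by (intro mult_left_mono) auto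
        also have "\<dots> = 2 * (r ^ 10 * \<Lambda>) * r ^ 8" unfolding r18 by simp
        finally show "\<Lambda> / r ^ 8 \<le> 2 * (r ^ 10 * \<Lambda> / y)"
          using y0 r8 by (simp add: field_simps)
      qed (use w in auto)
      finally show "(6 * A * \<Lambda> / w) * y * (1 / real L) \<le> (24 / w ^ 3) * (r ^ 10 * \<Lambda> / y)" by simp
      have "y * E = w * r ^ 16 * real L / y\<^sup>2 + 2 / y"
        unfolding E_def t using y0 by (simp add: field_simps power2_eq_square power3_eq_cube)
      also have "\<dots> \<le> w * r ^ 16 * (2 * (y / r ^ 8)) / y\<^sup>2 + 2 / y"
        using L(2) w r y0 by (intro add_right_mono divide_right_mono mult_left_mono) auto
      also have "\<dots> = (2 * w) * (r ^ 8 / y) + 2 / y"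
        unfolding r16 using y0 r8 rp by (simp add: field_simps power2_eq_square)
      also have "\<dots> \<le> (2 * w) * (r ^ 10 * \<Lambda> / y) + 2 * (r ^ 10 * \<Lambda> / y)"
      proof (intro add_mono mult_left_mono)
        show "r ^ 8 / y \<le> r ^ 10 * \<Lambda> / y" by fact
        have "1 / y \<le> r ^ 8 / y" using r1[of 8] y0 by (intro divide_right_mono) auto
        thus "2 / y \<le> 2 * (r ^ 10 * \<Lambda> / y)" using \<open>r ^ 8 / y \<le> r ^ 10 * \<Lambda> / y\<close> by simp
      qed (use w in auto)
      finally have "(2 / w) * (y * E) \<le> (2 / w) * ((2 * w) * (r ^ 10 * \<Lambda> / y) + 2 * (r ^ 10 * \<Lambda> / y))"
        using w by (intro mult_left_mono) auto
      also have "\<dots> = (4 + 4 / w) * (r ^ 10 * \<Lambda> / y)"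
        using w y0 by (simp add: field_simps)
      finally show "(2 / w) * (y * E) \<le> (4 + 4 / w) * (r ^ 10 * \<Lambda> / y)" .
    qed
    also have "\<dots> = C * (r ^ 10 * \<Lambda>) / y" by (simp add: C_def algebra_simps add_divide_distrib)
    finally show ?thesis .
  qed
  \<comment> \<open>As \<open>\<Lambda> \<ge> 1\<close>, a second factor \<open>\<Lambda>\<close>
    may be inserted to obtain a perfect square.\<close>
  also have "\<dots> \<le> C * (r ^ 5 * \<Lambda>)\<^sup>2 / y"
  proof -
    have "r ^ 10 * \<Lambda> * 1 \<le> r ^ 10 * \<Lambda> * \<Lambda>" using \<Lambda> r by (intro mult_left_mono) auto
    also have "\<dots> = (r ^ 5 * \<Lambda>)\<^sup>2" by (simp add: power2_eq_square flip: power_add)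
    finally show ?thesis using C0 y0 by (intro divide_right_mono mult_left_mono) auto
  qed
  finally have "sqrt (X / (real L)\<^sup>2) \<le> sqrt (C * (r ^ 5 * \<Lambda>)\<^sup>2 / y)"
    by (rule real_sqrt_le_mono)
  hence 2: "sqrt X / real L \<le> sqrt C * (r ^ 5 * \<Lambda>) / sqrt y"
    using L(4) r \<Lambda> by (simp add: real_sqrt_divide real_sqrt_mult)
  have 3: "real L / y \<le> 4 * (r ^ 5 * \<Lambda>) / sqrt y"
  proof -
    have "y \<le> 4 * r ^ 18" using y(2) y0 by linarith
    also have "\<dots> = (2 * r ^ 9)\<^sup>2" by (simp add: power_mult_distrib flip: power_mult)
    finally have sy: "sqrt y \<le> 2 * r ^ 9" using r by (intro real_le_lsqrt) auto
    have "real L / y * sqrt y \<le> 2 * (y / r ^ 8) / y * (2 * r ^ 9)"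
      using L(2) sy y0 by (intro mult_mono divide_right_mono) auto
    also have "\<dots> = 4 * r" unfolding r9 using y0 r8 rp by (simp add: field_simps)
    also have "\<dots> \<le> 4 * (r ^ 5 * \<Lambda>)"
      using mult_mono[of r "r ^ 5" 1 \<Lambda>] r \<Lambda> power_increasing[of 1 5 r] by simp
    finally show ?thesis using y0 by (simp add: pos_le_divide_eq)
  qed
  from 1 2 3 have "norm (\<Sum>n<M. z n) \<le> 4 * (r ^ 5 * \<Lambda>) / sqrt y + sqrt C * (r ^ 5 * \<Lambda>) / sqrt y"
    by linarith
  also have "\<dots> = (4 + sqrt C) * (r ^ 5 * \<Lambda>) / sqrt y"
    by (simp add: algebra_simps add_divide_distrib)
  finally show ?thesis by (simp add: z_def block_const_def C_def \<Lambda>_def)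
qed

text \<open>Summation by parts against the decreasing weight of exponent \<open>-1/2\<close> passes
  from \<open>1 + it\<close> to \<open>3/2 + it\<close> and gains the factor
  \<open>1 / sqrt y\<close>.\<close>

lemma weighted_block_bound:
  assumes w: "w > 0" and r: "r \<ge> 1" and t: "\<bar>t\<bar> = r ^ 16"
    and y: "r ^ 8 \<le> y" "y \<le> 2 * r ^ 18" and M: "real M * w \<le> y"
  shows "norm (\<Sum>n<M. pw (3 / 2 + \<i> * t) (y + w * real n)) \<le> block_const w * (r ^ 5 * (1 + 16 * ln r)) / y"
proof -
  define K where "K = block_const w * (r ^ 5 * (1 + 16 * ln r))"
  have "r ^ 8 > 0" using r by simp
  hence y0: "y > 0" using y(1) by linarith
  have pos: "y + w * real n > 0" for n using y0 w by (simp add: add_pos_nonneg)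
  have "norm (\<Sum>n<M. of_real ((y + w * real n) powr (- 1 / 2)) * pw (1 + \<i> * t) (y + w * real n))
      \<le> (y + w * real 0) powr (- 1 / 2) * (K / sqrt y)"
  proof (rule norm_sum_antimono_le)
    fix N assume "N \<le> M"
    hence "real N * w \<le> real M * w" using w by (intro mult_right_mono) auto
    hence "real N * w \<le> y" using M by linarith
    from block_bound[OF w r t y this]
    show "norm (\<Sum>n<N. pw (1 + \<i> * t) (y + w * real n)) \<le> K / sqrt y" by (simp add: K_def)
  next
    fix n show "(y + w * real (Suc n)) powr (- 1 / 2) \<le> (y + w * real n) powr (- 1 / 2)"
      using w pos[of n] by (intro powr_mono2') auto
  qed auto
  also have "(\<Sum>n<M. of_real ((y + w * real n) powr (- 1 / 2)) * pw (1 + \<i> * t) (y + w * real n)) =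
      (\<Sum>n<M. pw (3 / 2 + \<i> * t) (y + w * real n))"
  proof (rule sum.cong)
    fix n
    show "of_real ((y + w * real n) powr (- 1 / 2)) * pw (1 + \<i> * t) (y + w * real n) = pw (3 / 2 + \<i> * t) (y + w * real n)"
      using pos[of n] unfolding pw_def by (subst powr_of_real[symmetric]) (auto simp: powr_add[symmetric])
  qed simp
  also have "(y + w * real 0) powr (- 1 / 2) * (K / sqrt y) = K / y"
    using y0 by (simp add: powr_minus powr_half_sqrt field_simps)
  finally show ?thesis by (simp add: K_def)
qed

lemma block_const_pos: "w > 0 \<Longrightarrow> block_const w > 0"
  unfolding block_const_def by (intro add_pos_nonneg) auto

text \<open>The first block takes as many terms as fit into length \<open>y\<close>; what remains
  starts at \<open>y' \<ge> 3 / 2 * y\<close>, because \<open>2 * w \<le> r ^ 8 \<le> y\<close>. The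
  block bounds thus decay with ratio 2/3, and the constant 3 reproduces itself in the induction: 1 +
  3 * (2/3) = 3.\<close>

lemma dyadic_bound:
  assumes w: "w > 0" and r: "r \<ge> 1" and t: "\<bar>t\<bar> = r ^ 16" and rw: "2 * w \<le> r ^ 8"
    and "r ^ 8 \<le> y" "y + w * real M \<le> 2 * r ^ 18"
  shows "norm (\<Sum>n<M. pw (3 / 2 + \<i> * t) (y + w * real n)) \<le> 3 * block_const w * (r ^ 5 * (1 + 16 * ln r)) / y"
  using assms(5,6)
proof (induction M arbitrary: y rule: less_induct)
  case (less M)
  define K where "K = block_const w * (r ^ 5 * (1 + 16 * ln r))"
  have K: "K \<ge> 0" unfolding K_def using r block_const_pos[OF w] by (intro mult_nonneg_nonneg) auto
  have y0: "y > 0" using less.prems(1) rw w by linarith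
  have y2: "y \<le> 2 * r ^ 18"
    using less.prems(2) w mult_nonneg_nonneg[of w "real M"] by linarith
  show ?case
  proof (cases "real M * w \<le> y")
    case True
    have "norm (\<Sum>n<M. pw (3 / 2 + \<i> * t) (y + w * real n)) \<le> K / y"
      unfolding K_def by (rule weighted_block_bound[OF w r t less.prems(1) y2 True])
    also have "\<dots> \<le> 3 * K / y" using K y0 by (intro divide_right_mono) auto
    finally show ?thesis by (simp add: K_def mult.assoc)
  next
    case False
    define N where "N = nat \<lfloor>y / w\<rfloor>"
    have yw: "y / w \<ge> 2" using less.prems(1) rw w by (simp add: pos_le_divide_eq)
    have N: "real N \<le> y / w" "y / w < real N + 1" "N > 0"
      using yw unfolding N_def by linarith+
    have Nw: "real N * w \<le> y" "y < real N * w + w"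
      using N w by (simp_all add: field_simps)
    have NM: "N < M" using Nw(1) False w by (metis not_le_imp_less mult_right_mono of_nat_mono less_imp_le order_trans)
    define y' where "y' = y + w * real N"
    have y': "y' \<ge> 3 / 2 * y" unfolding y'_def using Nw(2) yw w less.prems(1) rw by (simp add: mult.commute)
    have y'pos: "y' > 0" using y' y0 by linarith
    have "(\<Sum>n<M. pw (3 / 2 + \<i> * t) (y + w * real n)) =
       (\<Sum>n<N. pw (3 / 2 + \<i> * t) (y + w * real n)) + (\<Sum>n<M - N. pw (3 / 2 + \<i> * t) (y' + w * real n))"
    proof -
      have "{..<M} = {..<N} \<union> {N..<M}" using NM by auto
      hence "(\<Sum>n<M. pw (3 / 2 + \<i> * t) (y + w * real n)) =
       (\<Sum>n<N. pw (3 / 2 + \<i> * t) (y + w * real n)) + (\<Sum>n=N..<M. pw (3 / 2 + \<i> * t) (y + w * real n))"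
        by (simp add: sum.union_disjoint ivl_disj_int)
      also have "(\<Sum>n=N..<M. pw (3 / 2 + \<i> * t) (y + w * real n)) = (\<Sum>n<M - N. pw (3 / 2 + \<i> * t) (y' + w * real n))"
        by (rule sum.reindex_bij_witness[of _ "\<lambda>n. n + N" "\<lambda>n. n - N"]) (use NM in \<open>auto simp: y'_def algebra_simps\<close>)
      finally show ?thesis .
    qed
    also have "norm \<dots> \<le> K / y + 3 * K / y'"
    proof (rule norm_triangle_mono)
      show "norm (\<Sum>n<N. pw (3 / 2 + \<i> * t) (y + w * real n)) \<le> K / y"
        unfolding K_def by (rule weighted_block_bound[OF w r t less.prems(1) y2 Nw(1)])
      have "norm (\<Sum>n<M - N. pw (3 / 2 + \<i> * t) (y' + w * real n)) \<le> 3 * block_const w * (r ^ 5 * (1 + 16 * ln r)) / y'"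
      proof (rule less.IH)
        show "M - N < M" using NM N(3) by simp
        show "r ^ 8 \<le> y'" using y' y0 less.prems(1) by linarith
        have "y' + w * real (M - N) = y + w * real M"
          unfolding y'_def using NM by (simp add: of_nat_diff algebra_simps)
        thus "y' + w * real (M - N) \<le> 2 * r ^ 18" using less.prems(2) by simp
      qed
      thus "norm (\<Sum>n<M - N. pw (3 / 2 + \<i> * t) (y' + w * real n)) \<le> 3 * K / y'"
        by (simp add: K_def mult.assoc)
    qed
    also have "3 * K / y' \<le> 3 * K / (3 / 2 * y)"
      using K y' y0 y'pos by (intro divide_left_mono mult_pos_pos) auto
    also have "K / y + 3 * K / (3 / 2 * y) = 3 * K / y" using y0 by (simp add: field_simps)
    finally show ?thesis by (simp add: K_def mult.assoc)
  qed
qed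

section \<open>The trapezoidal rule\<close>

text \<open>By \<open>pw_recursion\<close>, \<open>s / w * tent_integral w pw s y\<close> is the
  left endpoint value minus the mean over the step. Subtracting half the difference of the endpoint
  values leaves the error of the trapezoidal rule divided by \<open>w\<close>. As a function of the
  step length this error vanishes at zero together with its derivative, so two mean value bounds
  suffice.\<close>

lemma trapezoid_error:
  assumes w: "w > 0" and y: "y > 0" and s: "s \<noteq> 1" "Re s \<ge> 0"
  shows "norm (s / w * tent_integral w pw s y - (pw s y - pw s (y + w)) / 2) \<le>
    w\<^sup>2 * norm s * norm (s + 1) * y powr (- (Re s + 2)) / 2"
proof -
  define B where "B = w * norm s * norm (s + 1) * y powr (- (Re s + 2)) / 2"
  \<comment> \<open>\<open>\<phi> u\<close> is the trapezoidal error over [y, y + u], and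
    \<open>\<psi>\<close> is its derivative in \<open>u\<close>.\<close>
  define \<phi> where "\<phi> u = of_real u / 2 * (pw s y + pw s (y + u)) - (pw (s - 1) y - pw (s - 1) (y + u)) / (s - 1)" for u
  define \<psi> where "\<psi> u = (pw s y - pw s (y + u)) / 2 - of_real u * s / 2 * pw (s + 1) (y + u)" for u
  have pos: "y + u > 0" if "u \<in> {0..v}" for u v using that y by simp
  have id: "((\<lambda>u. complex_of_real u) has_vector_derivative 1) (at u within A)" for u A
    by (auto intro!: derivative_eq_intros)
  have \<phi>': "(\<phi> has_vector_derivative \<psi> u) (at u within {0..w})" if u: "u \<in> {0..w}" for u
  proof -
    have 1: "((\<lambda>u. pw s (y + u)) has_vector_derivative - s * pw (s + 1) (y + u)) (at u within {0..w})"
      by (rule has_vector_derivative_pw[OF pos[OF u]])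
    have 2: "((\<lambda>u. pw (s - 1) (y + u)) has_vector_derivative - (s - 1) * pw s (y + u)) (at u within {0..w})"
      using has_vector_derivative_pw[OF pos[OF u], of "s - 1"] by simp
    have "(\<phi> has_vector_derivative (of_real u / 2 * (0 + - s * pw (s + 1) (y + u)) + 1 / 2 * (pw s y + pw s (y + u)))
        - (0 - - (s - 1) * pw s (y + u)) / (s - 1)) (at u within {0..w})"
      unfolding \<phi>_def
      by (intro has_vector_derivative_diff has_vector_derivative_mult has_vector_derivative_divide
          has_vector_derivative_add has_vector_derivative_const 1 2 id)
    also have "(of_real u / 2 * (0 + - s * pw (s + 1) (y + u)) + 1 / 2 * (pw s y + pw s (y + u)))
        - (0 - - (s - 1) * pw s (y + u)) / (s - 1) = \<psi> u"
      using s(1) by (simp add: \<psi>_def field_simps)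
    finally show ?thesis .
  qed
  have \<psi>': "(\<psi> has_vector_derivative of_real u * s * (s + 1) / 2 * pw (s + 2) (y + u)) (at u within {0..v})"
    if u: "u \<in> {0..v}" for u v
  proof -
    have 1: "((\<lambda>u. pw s (y + u)) has_vector_derivative - s * pw (s + 1) (y + u)) (at u within {0..v})"
      by (rule has_vector_derivative_pw[OF pos[OF u]])
    have 2: "((\<lambda>u. pw (s + 1) (y + u)) has_vector_derivative - (s + 1) * pw (s + 2) (y + u)) (at u within {0..v})"
      using has_vector_derivative_pw[OF pos[OF u], of "s + 1"] by (simp add: add.assoc)
    have "(\<psi> has_vector_derivative (0 - - s * pw (s + 1) (y + u)) / 2
        - (of_real u * s / 2 * (- (s + 1) * pw (s + 2) (y + u)) + 1 * s / 2 * pw (s + 1) (y + u))) (at u within {0..v})"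
      unfolding \<psi>_def
      by (intro has_vector_derivative_diff has_vector_derivative_mult has_vector_derivative_divide
          has_vector_derivative_mult_left has_vector_derivative_const 1 2 id)
    also have "(0 - - s * pw (s + 1) (y + u)) / 2
        - (of_real u * s / 2 * (- (s + 1) * pw (s + 2) (y + u)) + 1 * s / 2 * pw (s + 1) (y + u)) =
        of_real u * s * (s + 1) / 2 * pw (s + 2) (y + u)"
      by (simp add: field_simps)
    finally show ?thesis .
  qed
  have n\<psi>: "norm (\<psi> u) \<le> B * w" if u: "u \<in> {0..w}" for u
  proof -
    have "norm (\<psi> u - \<psi> 0) \<le> B * u"
    proof (rule norm_diff_le_of_vector_derivative[OF _ \<psi>'])
      fix v assume v: "v \<in> {0..u}"
      have "norm (of_real v * s * (s + 1) / 2 * pw (s + 2) (y + v)) = v * norm s * norm (s + 1) / 2 * (y + v) powr (- (Re s + 2))"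
        using v norm_pw[OF pos[OF v], of "s + 2"] by (simp add: norm_mult norm_divide)
      also have "\<dots> \<le> w * norm s * norm (s + 1) / 2 * y powr (- (Re s + 2))"
        using v u y s by (intro mult_mono divide_right_mono powr_mono2' mult_right_mono) auto
      finally show "norm (of_real v * s * (s + 1) / 2 * pw (s + 2) (y + v)) \<le> B" by (simp add: B_def)
    qed (use u in auto)
    also have "\<dots> \<le> B * w" using u w by (intro mult_left_mono) (auto simp: B_def)
    finally show ?thesis by (simp add: \<psi>_def)
  qed
  have "norm (\<phi> w - \<phi> 0) \<le> B * w * w"
    by (rule norm_diff_le_of_vector_derivative[OF _ \<phi>' n\<psi>]) (use w in auto)
  hence "norm (\<phi> w) \<le> B * w * w" by (simp add: \<phi>_def)
  moreover have "s / w * tent_integral w pw s y - (pw s y - pw s (y + w)) / 2 = \<phi> w / w"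
  proof -
    have "s / w * tent_integral w pw s y = pw s y - (pw (s - 1) y - pw (s - 1) (y + w)) / (w * (s - 1))"
      using pw_recursion[OF s(1) y w] by (simp add: algebra_simps)
    moreover have "P - D / (W * S) - (P - P') / 2 = (W / 2 * (P + P') - D / S) / W" if "W \<noteq> 0" "S \<noteq> 0" for P P' D W S :: complex
      using that by (simp add: field_simps)
    ultimately show ?thesis using s(1) w unfolding \<phi>_def by simp
  qed
  ultimately have "norm (s / w * tent_integral w pw s y - (pw s y - pw s (y + w)) / 2) \<le> B * w * w / w"
    using w by (simp add: norm_divide pos_divide_le_eq)
  also have "\<dots> = w\<^sup>2 * norm s * norm (s + 1) * y powr (- (Re s + 2)) / 2"
    using w by (simp add: B_def power2_eq_square)
  finally show ?thesis .
qed

text \<open>For \<open>Re s > 1\<close> this is the Hurwitz series minus its main term x^(1 - s) /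
  (w (s - 1)), by \<open>hurwitz_recursion\<close>. In the integral form it is exactly the term
  summed over \<open>m\<close> in \<open>barnes_zeta2_eq\<close>.\<close>

definition euler_maclaurin_rest :: "real \<Rightarrow> complex \<Rightarrow> real \<Rightarrow> complex" where
  "euler_maclaurin_rest w s x = s / w * tent_integral w (lattice_sum w pw) s x"

text \<open>The halved endpoint differences telescope to \<open>pw s x / 2\<close>; the trapezoidal
  errors are summed by comparison with an integral, where \<open>x \<ge> w\<close> absorbs the
  separate first term. The constant 12 comes from |s| <= 3 |t| and |s + 1| <= 4 |t|.\<close>

lemma norm_euler_maclaurin_rest_le:
  fixes t :: real
  assumes w: "w > 0" and x: "x \<ge> w" and t: "\<bar>t\<bar> \<ge> 1"
  shows "norm (euler_maclaurin_rest w (3 / 2 + \<i> * t) x) \<le> x powr (- (3 / 2)) + 12 * w * t\<^sup>2 * x powr (- (5 / 2))"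
proof -
  define s where "s = 3 / 2 + \<i> * complex_of_real t"
  have x0: "x > 0" using w x by simp
  have Re: "Re s = 3 / 2" by (simp add: s_def)
  have s1: "s \<noteq> 1" using Re by auto
  have pos: "x + w * real n > 0" for n using x0 w by (simp add: add_pos_nonneg)
  have lim: "(\<lambda>n. pw s (x + w * real n)) \<longlonglongrightarrow> 0"
    using summable_lattice_sum[OF w decaying_pw, of s x] Re x0
    by (intro tendsto_norm_zero_cancel[OF summable_LIMSEQ_zero]) auto
  have "(\<lambda>n. pw s (x + w * real n) - pw s (x + w * real (Suc n))) sums (pw s (x + w * real 0) - 0)"
    by (rule telescope_sums'[OF lim])
  hence 1: "(\<lambda>n. (pw s (x + w * real n) - pw s (x + w * real n + w)) / 2) sums (pw s x / 2)"
    using sums_divide[of _ "pw s x" 2] by (simp add: algebra_simps)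
  have 2: "(\<lambda>n. s / w * tent_integral w pw s (x + w * real n)) sums euler_maclaurin_rest w s x"
    unfolding euler_maclaurin_rest_def
    using Re w x0 by (intro sums_mult tent_integral_lattice_sums[OF regular_pw[of 0] decaying_pw]) auto
  define c where "c = w\<^sup>2 * norm s * norm (s + 1) / 2"
  have c0: "c \<ge> 0" by (simp add: c_def)
  define e where "e n = s / w * tent_integral w pw s (x + w * real n) - (pw s (x + w * real n) - pw s (x + w * real n + w)) / 2" for n
  have e: "norm (e n) \<le> c * (x + w * real n) powr (- (7 / 2))" for n
    using trapezoid_error[OF w pos[of n] s1] Re by (simp add: e_def c_def)
  have "e sums (euler_maclaurin_rest w s x - pw s x / 2)"
    unfolding e_def by (rule sums_diff[OF 2 1])
  hence "euler_maclaurin_rest w s x - pw s x / 2 = (\<Sum>n. e n)" by (rule sums_unique)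
  also have "norm \<dots> \<le> (\<Sum>n. c * (x + w * real n) powr (- (7 / 2)))"
    using e summable_mult[OF summable_powr_lattice[OF x0 w, of "7 / 2"], of c] by (intro norm_suminf_le) auto
  also have "\<dots> = c * (\<Sum>n. (x + w * real n) powr (- (7 / 2)))"
    by (intro suminf_mult summable_powr_lattice x0 w) simp
  also have "\<dots> \<le> c * (x powr (- (7 / 2)) + x powr (1 - 7 / 2) / (w * (7 / 2 - 1)))"
    using suminf_powr_le[OF x0 w, of "7 / 2"] c0 by (intro mult_left_mono) auto
  also have "x powr (- (7 / 2)) \<le> x powr (- (5 / 2)) / w"
  proof -
    have "x powr (- (7 / 2)) = x powr (- (5 / 2)) / x"
      using x0 powr_diff[of x "- (5 / 2)" 1] by simp
    also have "\<dots> \<le> x powr (- (5 / 2)) / w" using x w by (intro divide_left_mono) auto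
    finally show ?thesis .
  qed
  also have "x powr (1 - 7 / 2) / (w * (7 / 2 - 1)) \<le> x powr (- (5 / 2)) / w"
    using w by (simp add: field_simps)
  also have "c * (x powr (- (5 / 2)) / w + x powr (- (5 / 2)) / w) = w * (norm s * norm (s + 1)) * x powr (- (5 / 2))"
    using w by (simp add: c_def field_simps power2_eq_square)
  also have "\<dots> \<le> w * (12 * t\<^sup>2) * x powr (- (5 / 2))"
  proof (intro mult_right_mono mult_left_mono)
    have "norm s \<le> norm (3 / 2 :: complex) + norm (\<i> * complex_of_real t)" unfolding s_def by (rule norm_triangle_ineq)
    hence 1: "norm s \<le> 3 * \<bar>t\<bar>" using t by (simp add: norm_mult)
    have "norm (s + 1) \<le> norm s + norm (1 :: complex)" by (rule norm_triangle_ineq)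
    hence "norm (s + 1) \<le> 4 * \<bar>t\<bar>" using t 1 by simp
    with 1 have "norm s * norm (s + 1) \<le> 3 * \<bar>t\<bar> * (4 * \<bar>t\<bar>)" by (intro mult_mono) auto
    also have "\<dots> = 12 * t\<^sup>2" by (simp add: power2_eq_square flip: abs_mult)
    finally show "norm s * norm (s + 1) \<le> 12 * t\<^sup>2" .
  qed (use w in auto)
  finally have "norm (euler_maclaurin_rest w s x - pw s x / 2) \<le> w * (12 * t\<^sup>2) * x powr (- (5 / 2))"
    using c0 by (simp add: mult_left_mono add_mono)
  moreover have "norm (pw s x / 2) \<le> x powr (- (3 / 2))"
    using norm_pw[OF x0, of s] Re by (simp add: norm_divide)
  moreover have "norm (euler_maclaurin_rest w s x) \<le> norm (euler_maclaurin_rest w s x - pw s x / 2) + norm (pw s x / 2)"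
    using norm_triangle_ineq[of "euler_maclaurin_rest w s x - pw s x / 2" "pw s x / 2"] by simp
  ultimately show ?thesis unfolding s_def by simp
qed

lemma lattice_sum_split:
  assumes "w > 0" "x > 0" "Re s > 1"
  shows "lattice_sum w pw s x = (\<Sum>n<N. pw s (x + w * real n)) + lattice_sum w pw s (x + w * real N)"
proof -
  have "summable (\<lambda>n. pw s (x + w * real n))"
    by (rule summable_norm_cancel, rule summable_lattice_sum[OF assms(1) decaying_pw]) (use assms in auto)
  from suminf_split_initial_segment[OF this, of N]
  show ?thesis by (simp add: lattice_sum_def algebra_simps)
qed

lemma steps_above:
  fixes a v T :: real
  assumes "v > 0" "a < T"
  obtains N where "a + v * real N \<ge> T" "a + v * real N < T + v" "\<And>m. m < N \<Longrightarrow> a + v * real m < T"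
proof -
  define N where "N = nat \<lceil>(T - a) / v\<rceil>"
  have q: "(T - a) / v > 0" using assms by simp
  have "real N \<ge> (T - a) / v" "real N < (T - a) / v + 1" using q unfolding N_def by linarith+
  hence 1: "a + v * real N \<ge> T" "a + v * real N < T + v"
    using assms by (simp_all add: field_simps)
  have "a + v * real m < T" if "m < N" for m
  proof -
    have "v * (real m + 1) \<le> v * real N" using that assms by (intro mult_left_mono) auto
    thus ?thesis using 1(2) by (simp add: distrib_left)
  qed
  with 1 show ?thesis by (rule that)
qed

section \<open>The bound on the line of real part three halves\<close>

lemma power_powr: "r > 0 \<Longrightarrow> (r ^ k) powr p = r powr (real k * p)" for r :: real
  by (simp add: powr_realpow[symmetric] powr_powr)

lemma norm_pw_div_le:
  fixes t :: real
  assumes "w > 0" "t \<noteq> 0" "y > 0"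
  shows "norm (pw (3 / 2 + \<i> * t - 1) y / (w * (3 / 2 + \<i> * t - 1))) \<le> y powr (- (1 / 2)) / (w * \<bar>t\<bar>)"
proof -
  have "\<bar>t\<bar> \<le> norm (3 / 2 + \<i> * complex_of_real t - 1)"
    using abs_Im_le_cmod[of "3 / 2 + \<i> * complex_of_real t - 1"] by simp
  moreover have "norm (pw (3 / 2 + \<i> * t - 1) y) = y powr (- (1 / 2))"
    using norm_pw[OF assms(3), of "3 / 2 + \<i> * t - 1"] by simp
  ultimately have "norm (pw (3 / 2 + \<i> * t - 1) y) / (w * norm (3 / 2 + \<i> * complex_of_real t - 1)) \<le> y powr (- (1 / 2)) / (w * \<bar>t\<bar>)"
    using assms by (intro frac_le mult_left_mono) auto
  thus ?thesis using assms(1) by (simp only: norm_divide norm_mult norm_of_real abs_of_pos)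
qed

text \<open>Two instances of \<open>hurwitz_recursion\<close>, at \<open>x\<close> and at
  \<open>x + w * real N\<close>, are subtracted. This moves the trapezoidal rule out to a point
  where it is accurate, at the price of a finite exponential sum.\<close>

lemma euler_maclaurin_rest_eq:
  assumes "w > 0" "x > 0" "Re s > 1"
  shows "euler_maclaurin_rest w s x = (\<Sum>n<N. pw s (x + w * real n)) + euler_maclaurin_rest w s (x + w * real N)
    + pw (s - 1) (x + w * real N) / (w * (s - 1)) - pw (s - 1) x / (w * (s - 1))"
proof -
  have "x + w * real N > 0" using assms by (simp add: add_pos_nonneg)
  from hurwitz_recursion[OF assms(1,3) this] hurwitz_recursion[OF assms(1,3,2)] lattice_sum_split[OF assms, of N]
  show ?thesis unfolding euler_maclaurin_rest_def by (simp add: algebra_simps)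
qed

definition rest_const :: "real \<Rightarrow> real \<Rightarrow> real" where
  "rest_const \<alpha> w = 3 * block_const w + 1 / \<alpha> + 4 / w + 1 + 12 * w"

text \<open>Terms below \<open>r ^ 8\<close>, the range not reached by the dyadic bound, are
  estimated by absolute values: their sum is of order \<open>sqrt x / x\<close>, and
  \<open>sqrt x \<le> r ^ 4\<close> there. From the first point beyond \<open>r ^ 8\<close> the
  dyadic bound takes over.\<close>

lemma norm_finite_sum_le:
  fixes t :: real
  assumes w: "w > 0" and \<alpha>: "\<alpha> > 0" and r: "r \<ge> 1" and t: "\<bar>t\<bar> = r ^ 16" and rw: "2 * w \<le> r ^ 8"
    and x: "\<alpha> \<le> x" and N: "r ^ 18 \<le> x + w * real N" "x + w * real N \<le> 2 * r ^ 18"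
  shows "norm (\<Sum>n<N. pw (3 / 2 + \<i> * t) (x + w * real n)) \<le>
    (3 * block_const w + 1 / \<alpha> + 2 / w) * (r ^ 5 * (1 + 16 * ln r)) / x"
proof -
  define K where "K = r ^ 5 * (1 + 16 * ln r)"
  have K: "K \<ge> r ^ 5"
    using mult_left_mono[of 1 "1 + 16 * ln r" "r ^ 5"] r by (simp add: K_def)
  have K0: "K \<ge> 0" using K r by (meson order_trans zero_le_power zero_le_one)
  have x0: "x > 0" using x \<alpha> by linarith
  have bc: "block_const w \<ge> 0" using block_const_pos[OF w] by simp
  have r8: "r ^ 8 > 0" using r by simp
  have "norm (\<Sum>n<N. pw (3 / 2 + \<i> * t) (x + w * real n)) \<le> (3 * block_const w + 1 / \<alpha> + 2 / w) * K / x"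
  proof (cases "r ^ 8 \<le> x")
    case True
    have "norm (\<Sum>n<N. pw (3 / 2 + \<i> * t) (x + w * real n)) \<le> 3 * block_const w * K / x"
      unfolding K_def by (rule dyadic_bound[OF w r t rw True N(2)])
    also have "\<dots> \<le> (3 * block_const w + 1 / \<alpha> + 2 / w) * K / x"
      using K0 x0 \<alpha> w by (intro divide_right_mono mult_right_mono) auto
    finally show ?thesis .
  next
    case False
    then obtain M where M: "x + w * real M \<ge> r ^ 8" "x + w * real M < r ^ 8 + w" "\<And>m. m < M \<Longrightarrow> x + w * real m < r ^ 8"
      using steps_above[OF w, of x "r ^ 8"] by (metis not_le_imp_less)
    have "r ^ 8 \<le> r ^ 18" using r by (intro power_increasing) auto
    hence MN: "M \<le> N" using M(3)[of N] N(1) by (meson leI not_le order_trans less_le_not_le)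
    define x' where "x' = x + w * real M"
    have "(\<Sum>n<N. pw (3 / 2 + \<i> * t) (x + w * real n)) =
       (\<Sum>n<M. pw (3 / 2 + \<i> * t) (x + w * real n)) + (\<Sum>n<N - M. pw (3 / 2 + \<i> * t) (x' + w * real n))"
    proof -
      have "{..<N} = {..<M} \<union> {M..<N}" using MN by auto
      hence "(\<Sum>n<N. pw (3 / 2 + \<i> * t) (x + w * real n)) =
       (\<Sum>n<M. pw (3 / 2 + \<i> * t) (x + w * real n)) + (\<Sum>n=M..<N. pw (3 / 2 + \<i> * t) (x + w * real n))"
        by (simp add: sum.union_disjoint ivl_disj_int)
      also have "(\<Sum>n=M..<N. pw (3 / 2 + \<i> * t) (x + w * real n)) = (\<Sum>n<N - M. pw (3 / 2 + \<i> * t) (x' + w * real n))"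
        by (rule sum.reindex_bij_witness[of _ "\<lambda>n. n + M" "\<lambda>n. n - M"]) (use MN in \<open>auto simp: x'_def algebra_simps\<close>)
      finally show ?thesis .
    qed
    also have "norm \<dots> \<le> (1 / \<alpha> + 2 / w) * K / x + 3 * block_const w * K / x"
    proof (rule norm_triangle_mono)
      have "norm (\<Sum>n<M. pw (3 / 2 + \<i> * t) (x + w * real n)) \<le> (\<Sum>n<M. (x + w * real n) powr (- (3 / 2)))"
      proof (rule sum_norm_le)
        fix n
        have "x + w * real n > 0" using x0 w by (simp add: add_pos_nonneg)
        from norm_pw[OF this, of "3 / 2 + \<i> * t"]
        show "norm (pw (3 / 2 + \<i> * t) (x + w * real n)) \<le> (x + w * real n) powr (- (3 / 2))" by simp
      qed
      also have "\<dots> \<le> x powr (- (3 / 2)) + x powr (1 - 3 / 2) / (w * (3 / 2 - 1))"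
        by (rule sum_powr_le) (use x0 w in auto)
      also have "x powr (1 - 3 / 2) = sqrt x / x"
        using x0 powr_diff[of x "1 / 2" 1] by (simp add: powr_half_sqrt)
      also have "x powr (- (3 / 2)) = sqrt x / x / x"
        using x0 powr_diff[of x "1 / 2" 2] by (simp add: powr_half_sqrt power2_eq_square)
      also have "sqrt x / x / x + sqrt x / x / (w * (3 / 2 - 1)) = sqrt x * ((1 / x + 2 / w) / x)"
        using x0 w by (simp add: field_simps)
      also have "\<dots> \<le> K * ((1 / \<alpha> + 2 / w) / x)"
      proof (rule mult_mono)
        have "sqrt x \<le> r ^ 4"
          using False r by (intro real_le_lsqrt) (auto simp flip: power_mult)
        also have "\<dots> \<le> r ^ 5" using r by (intro power_increasing) auto
        finally show "sqrt x \<le> K" using K by linarith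
        have "1 / x \<le> 1 / \<alpha>" using x \<alpha> x0 by (intro divide_left_mono mult_pos_pos) auto
        thus "(1 / x + 2 / w) / x \<le> (1 / \<alpha> + 2 / w) / x" using x0 by (intro divide_right_mono add_right_mono) auto
      qed (use K0 x0 w in auto)
      finally show "norm (\<Sum>n<M. pw (3 / 2 + \<i> * t) (x + w * real n)) \<le> (1 / \<alpha> + 2 / w) * K / x"
        by (simp add: mult_ac)
      have "norm (\<Sum>n<N - M. pw (3 / 2 + \<i> * t) (x' + w * real n)) \<le> 3 * block_const w * K / x'"
        unfolding K_def
      proof (rule dyadic_bound[OF w r t rw])
        have "x' + w * real (N - M) = x + w * real N"
          unfolding x'_def using MN by (simp add: of_nat_diff algebra_simps)
        thus "x' + w * real (N - M) \<le> 2 * r ^ 18" using N(2) by simp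
      qed (use M(1) in \<open>simp add: x'_def\<close>)
      also have "\<dots> \<le> 3 * block_const w * K / x"
        using K0 bc x0 w unfolding x'_def by (intro divide_left_mono mult_nonneg_nonneg mult_pos_pos) (auto simp: add_pos_nonneg)
      finally show "norm (\<Sum>n<N - M. pw (3 / 2 + \<i> * t) (x' + w * real n)) \<le> 3 * block_const w * K / x" .
    qed
    also have "\<dots> = (3 * block_const w + 1 / \<alpha> + 2 / w) * K / x"
      by (simp add: distrib_right add_divide_distrib)
    finally show ?thesis .
  qed
  thus ?thesis by (simp add: K_def)
qed

text \<open>The trapezoidal rule is applied at the first point \<open>y\<close> beyond
  \<open>r ^ 18\<close>. Its error is of order r^(-13), where -13 = 32 - 45, and r^(-13) <= r^5 / x
  as \<open>x < r ^ 18\<close>. The finite sum before \<open>y\<close> is the one treated by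
  differencing; the two boundary powers are harmless thanks to the factor 1 / |t|.\<close>

lemma norm_rest_le:
  fixes t :: real
  assumes w: "w > 0" and \<alpha>: "\<alpha> > 0" and r: "r \<ge> 1" and t: "\<bar>t\<bar> = r ^ 16" and rw: "2 * w \<le> r ^ 8"
    and x: "\<alpha> \<le> x" "x < r ^ 18"
  shows "norm (euler_maclaurin_rest w (3 / 2 + \<i> * t) x) \<le> rest_const \<alpha> w * (r ^ 5 * (1 + 16 * ln r)) / x"
proof -
  define K where "K = r ^ 5 * (1 + 16 * ln r)"
  have K: "K \<ge> r ^ 5"
    using mult_left_mono[of 1 "1 + 16 * ln r" "r ^ 5"] r by (simp add: K_def)
  have K1: "K \<ge> 1" using K one_le_power[OF r, of 5] by linarith
  have x0: "x > 0" using x \<alpha> by linarith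
  have rp: "r > 0" using r by simp
  have t1: "\<bar>t\<bar> \<ge> 1" using one_le_power[OF r, of 16] t by simp
  have r818: "r ^ 8 \<le> r ^ 18" using r by (intro power_increasing) auto
  obtain N where N: "x + w * real N \<ge> r ^ 18" "x + w * real N < r ^ 18 + w"
    using steps_above[OF w x(2)] by metis
  define s where "s = 3 / 2 + \<i> * complex_of_real t"
  define y where "y = x + w * real N"
  have y: "y \<ge> r ^ 18" "y \<ge> w" "y > 0" "y \<ge> x"
    using N rw r818 w x(2) x0 unfolding y_def by auto
  have Re: "Re s > 1" by (simp add: s_def)
  have "norm (euler_maclaurin_rest w s y) \<le> y powr (- (3 / 2)) + 12 * w * t\<^sup>2 * y powr (- (5 / 2))"
    unfolding s_def by (rule norm_euler_maclaurin_rest_le[OF w y(2) t1])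
  also have "\<dots> \<le> 1 / r ^ 13 + 12 * w * r ^ 32 * (1 / r ^ 45)"
  proof (intro add_mono mult_mono)
    have "y powr (- (3 / 2)) \<le> (r ^ 18) powr (- (3 / 2))"
      using y(1) rp by (intro powr_mono2') auto
    also have "\<dots> = 1 / r ^ 27" using rp by (simp add: power_powr powr_minus inverse_eq_divide)
    also have "\<dots> \<le> 1 / r ^ 13" using r by (intro divide_left_mono power_increasing) auto
    finally show "y powr (- (3 / 2)) \<le> 1 / r ^ 13" .
    have "y powr (- (5 / 2)) \<le> (r ^ 18) powr (- (5 / 2))"
      using y(1) rp by (intro powr_mono2') auto
    also have "\<dots> = 1 / r ^ 45" using rp by (simp add: power_powr powr_minus inverse_eq_divide)
    finally show "y powr (- (5 / 2)) \<le> 1 / r ^ 45" .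
    have "t\<^sup>2 = (r ^ 16)\<^sup>2" using t by (metis power2_abs)
    thus "t\<^sup>2 \<le> r ^ 32" by (simp flip: power_mult)
  qed (use w rp in auto)
  also have "12 * w * r ^ 32 * (1 / r ^ 45) = 12 * w * (1 / r ^ 13)"
  proof -
    have "r ^ 32 / (r ^ 32 * r ^ 13) = 1 / r ^ 13"
      by (rule nonzero_divide_mult_cancel_left) (use rp in simp)
    moreover have "r ^ 32 * r ^ 13 = r ^ 45" by (simp flip: power_add)
    ultimately have "r ^ 32 / r ^ 45 = 1 / r ^ 13" by (simp only:)
    moreover have "12 * w * r ^ 32 * (1 / r ^ 45) = 12 * w * (r ^ 32 / r ^ 45)" by simp
    ultimately show ?thesis by (simp only:)
  qed
  also have "1 / r ^ 13 + 12 * w * (1 / r ^ 13) = (1 + 12 * w) * (1 / r ^ 13)" by (simp only: distrib_right mult_1_left)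
  also have "\<dots> \<le> (1 + 12 * w) * (K / x)"
  proof (rule mult_left_mono)
    have "x \<le> r ^ 5 * r ^ 13" using x(2) by (simp flip: power_add)
    also have "\<dots> \<le> K * r ^ 13" using K rp by (intro mult_right_mono) auto
    finally show "1 / r ^ 13 \<le> K / x" using x0 rp by (simp add: field_simps)
  qed (use w in auto)
  finally have 1: "norm (euler_maclaurin_rest w s y) \<le> (1 + 12 * w) * (K / x)" .
  have 2: "norm (pw (s - 1) z / (w * (s - 1))) \<le> (1 / w) * (K / x)" if "z \<ge> x" for z
  proof -
    have "norm (pw (s - 1) z / (w * (s - 1))) \<le> z powr (- (1 / 2)) / (w * \<bar>t\<bar>)"
      unfolding s_def using that x0 t1 w by (intro norm_pw_div_le) auto
    also have "\<dots> \<le> x powr (- (1 / 2)) / (w * \<bar>t\<bar>)"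
      using that x0 w by (intro divide_right_mono powr_mono2') auto
    also have "x powr (- (1 / 2)) = sqrt x / x"
      using x0 powr_diff[of x "1 / 2" 1] by (simp add: powr_half_sqrt)
    also have "sqrt x / x / (w * \<bar>t\<bar>) = (1 / w) * (sqrt x / \<bar>t\<bar> / x)"
      using w x0 by simp
    also have "\<dots> \<le> (1 / w) * (K / x)"
    proof (intro mult_left_mono divide_right_mono)
      have "sqrt x \<le> r ^ 9" using x r by (intro real_le_lsqrt) (auto simp flip: power_mult)
      also have "\<dots> \<le> r ^ 16" using r by (intro power_increasing) auto
      finally have "sqrt x \<le> \<bar>t\<bar>" unfolding t .
      hence "sqrt x / \<bar>t\<bar> \<le> 1" using t1 by (subst pos_divide_le_eq) auto
      thus "sqrt x / \<bar>t\<bar> \<le> K" using K1 by linarith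
    qed (use x0 w in auto)
    finally show ?thesis .
  qed
  have 3: "norm (\<Sum>n<N. pw s (x + w * real n)) \<le> (3 * block_const w + 1 / \<alpha> + 2 / w) * (K / x)"
  proof -
    have "w \<le> r ^ 18" using rw r818 w by linarith
    hence "x + w * real N \<le> 2 * r ^ 18" using N(2) by linarith
    from norm_finite_sum_le[OF w \<alpha> r t rw x(1) N(1) this] show ?thesis by (simp add: s_def K_def)
  qed
  have "euler_maclaurin_rest w s x = (\<Sum>n<N. pw s (x + w * real n)) + euler_maclaurin_rest w s y
    + pw (s - 1) y / (w * (s - 1)) - pw (s - 1) x / (w * (s - 1))"
    unfolding y_def by (rule euler_maclaurin_rest_eq[OF w x0 Re])
  also have "norm \<dots> \<le> (3 * block_const w + 1 / \<alpha> + 2 / w) * (K / x) + (1 + 12 * w) * (K / x) + (1 / w) * (K / x) + (1 / w) * (K / x)"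
    by (intro norm_triangle_mono norm_triangle_le_diff add_mono 1 2 3 y(4) order_refl)
  also have "\<dots> = rest_const \<alpha> w * K / x"
    using w by (simp add: rest_const_def algebra_simps add_divide_distrib)
  finally show ?thesis by (simp add: s_def K_def)
qed

text \<open>Below T = r^18 the terms are bounded by r^5 times a logarithm over \<open>x\<close>, and
  summing 1/x over \<open>m\<close> brings the second logarithm. Beyond T the trapezoidal bound
  alone sums to order |t|^2 T^(-3/2) = r^5. For T = r^k the two parts would have exponents (k - 8)/2
  and 32 - 3k/2, which agree exactly at k = 18.\<close>

lemma norm_rest_suminf_le:
  fixes t :: real
  assumes v: "v > 0" and w: "w > 0" and \<alpha>: "\<alpha> > 0" and r: "r \<ge> 1" and t: "\<bar>t\<bar> = r ^ 16"
    and rw: "2 * w \<le> r ^ 8" and rv: "v \<le> r ^ 18" and r\<alpha>: "\<alpha> < r ^ 18"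
  shows "norm (\<Sum>m. euler_maclaurin_rest w (3 / 2 + \<i> * t) (\<alpha> + v * real m)) \<le>
    (rest_const \<alpha> w * (1 / \<alpha> + (2 + \<bar>ln \<alpha>\<bar>) / v) + (1 + 2 / v) + 12 * w * (1 + 1 / v)) * (r ^ 5 * (1 + 16 * ln r)\<^sup>2)"
proof -
  define \<Lambda> where "\<Lambda> = 1 + 16 * ln r"
  have \<Lambda>: "\<Lambda> \<ge> 1" using r by (simp add: \<Lambda>_def)
  have rp: "r > 0" using r by simp
  have t1: "\<bar>t\<bar> \<ge> 1" using one_le_power[OF r, of 16] t by simp
  have r818: "r ^ 8 \<le> r ^ 18" using r by (intro power_increasing) auto
  define s where "s = 3 / 2 + \<i> * complex_of_real t"
  define D where "D x = euler_maclaurin_rest w s x" for x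
  obtain N where N: "\<alpha> + v * real N \<ge> r ^ 18" "\<alpha> + v * real N < r ^ 18 + v"
    "\<And>m. m < N \<Longrightarrow> \<alpha> + v * real m < r ^ 18"
    using steps_above[OF v r\<alpha>] by metis
  define Y where "Y = \<alpha> + v * real N"
  have Y: "Y \<ge> r ^ 18" "Y \<ge> w" "Y > 0" "Y \<ge> 1" "Y \<le> 2 * r ^ 18"
    using N rw r818 w r\<alpha> \<alpha> rv one_le_power[OF r, of 18] unfolding Y_def by auto
  \<comment> \<open>Convergence at real part \<open>3/2\<close> comes from termwise integration at
    \<open>s + 1\<close>, where the double series converges absolutely.\<close>
  have "(\<lambda>m. D (\<alpha> + v * real m)) sums (s / w * tent_integral w (barnes_sum v w) s \<alpha>)"
    unfolding D_def euler_maclaurin_rest_def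
    by (intro sums_mult tent_integral_lattice_sums[OF regular_hurwitz decaying_hurwitz])
       (use v w \<alpha> in \<open>auto simp: s_def\<close>)
  hence "summable (\<lambda>m. D (\<alpha> + v * real m))" by (rule sums_summable)
  from suminf_split_initial_segment[OF this, of N]
  have "(\<Sum>m. D (\<alpha> + v * real m)) = (\<Sum>m. D (Y + v * real m)) + (\<Sum>m<N. D (\<alpha> + v * real m))"
    by (simp add: Y_def algebra_simps)
  also have "norm \<dots> \<le> ((1 + 2 / v) + 12 * w * (1 + 1 / v)) * (r ^ 5 * \<Lambda>\<^sup>2) +
      rest_const \<alpha> w * (1 / \<alpha> + (2 + \<bar>ln \<alpha>\<bar>) / v) * (r ^ 5 * \<Lambda>\<^sup>2)"
  proof (rule norm_triangle_mono)
    have rc: "rest_const \<alpha> w \<ge> 0"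
      using block_const_pos[OF w] \<alpha> w by (simp add: rest_const_def)
    have "norm (\<Sum>m<N. D (\<alpha> + v * real m)) \<le> (\<Sum>m<N. rest_const \<alpha> w * (r ^ 5 * \<Lambda>) * (1 / (\<alpha> + v * real m)))"
    proof (rule sum_norm_le)
      fix m assume "m \<in> {..<N}"
      hence "\<alpha> + v * real m < r ^ 18" using N(3) by simp
      from norm_rest_le[OF w \<alpha> r t rw _ this] v
      show "norm (D (\<alpha> + v * real m)) \<le> rest_const \<alpha> w * (r ^ 5 * \<Lambda>) * (1 / (\<alpha> + v * real m))"
        by (simp add: D_def s_def \<Lambda>_def)
    qed
    also have "\<dots> = rest_const \<alpha> w * (r ^ 5 * \<Lambda>) * (\<Sum>m<N. 1 / (\<alpha> + v * real m))"
      by (simp only: sum_distrib_left)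
    also have "\<dots> \<le> rest_const \<alpha> w * (r ^ 5 * \<Lambda>) * ((1 / \<alpha> + (2 + \<bar>ln \<alpha>\<bar>) / v) * \<Lambda>)"
    proof (rule mult_left_mono)
      have "ln Y \<le> ln (2 * r ^ 18)" using Y(3,5) rp by simp
      also have "\<dots> = ln 2 + 18 * ln r" using rp by (simp add: ln_mult ln_realpow)
      also have "\<dots> \<le> 2 * \<Lambda>" using ln_2_less_1 ln_ge_zero[OF r] unfolding \<Lambda>_def by argo
      finally have "ln Y - ln \<alpha> \<le> 2 * \<Lambda> + \<bar>ln \<alpha>\<bar>" by linarith
      also have "\<bar>ln \<alpha>\<bar> \<le> \<bar>ln \<alpha>\<bar> * \<Lambda>" using mult_left_mono[OF \<Lambda>, of "\<bar>ln \<alpha>\<bar>"] by simp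
      finally have "ln Y - ln \<alpha> \<le> (2 + \<bar>ln \<alpha>\<bar>) * \<Lambda>" by (simp add: algebra_simps)
      hence "(ln Y - ln \<alpha>) / v \<le> (2 + \<bar>ln \<alpha>\<bar>) / v * \<Lambda>"
        using v divide_right_mono[of "ln Y - ln \<alpha>" _ v] by fastforce
      moreover have "1 / \<alpha> \<le> 1 / \<alpha> * \<Lambda>" using mult_left_mono[OF \<Lambda>, of "1 / \<alpha>"] \<alpha> by simp
      ultimately show "(\<Sum>m<N. 1 / (\<alpha> + v * real m)) \<le> (1 / \<alpha> + (2 + \<bar>ln \<alpha>\<bar>) / v) * \<Lambda>"
        using sum_inverse_le_ln[OF \<alpha> v, of N] unfolding Y_def distrib_right by linarith
    qed (use rc rp \<Lambda> in auto)
    also have "\<dots> = rest_const \<alpha> w * (1 / \<alpha> + (2 + \<bar>ln \<alpha>\<bar>) / v) * (r ^ 5 * \<Lambda>\<^sup>2)"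
      by (simp only: power2_eq_square mult_ac)
    finally show "norm (\<Sum>m<N. D (\<alpha> + v * real m)) \<le> rest_const \<alpha> w * (1 / \<alpha> + (2 + \<bar>ln \<alpha>\<bar>) / v) * (r ^ 5 * \<Lambda>\<^sup>2)" .
  next
    define c where "c = 12 * w * r ^ 32"
    have c0: "c \<ge> 0" using w rp by (simp add: c_def)
    have s3: "summable (\<lambda>m. (Y + v * real m) powr (- (3 / 2)))" and s5: "summable (\<lambda>m. (Y + v * real m) powr (- (5 / 2)))"
      using Y(3) v by (auto intro!: summable_powr_lattice simp del: minus_divide_left)
    have "norm (\<Sum>m. D (Y + v * real m)) \<le> (\<Sum>m. (Y + v * real m) powr (- (3 / 2)) + c * (Y + v * real m) powr (- (5 / 2)))"
    proof (rule norm_suminf_le)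
      fix m
      have "t\<^sup>2 = (r ^ 16)\<^sup>2" using t by (metis power2_abs)
      hence t2: "t\<^sup>2 = r ^ 32" by (simp flip: power_mult)
      have "Y + v * real m \<ge> w" using Y(2) v by (simp add: add_increasing2)
      from norm_euler_maclaurin_rest_le[OF w this t1]
      show "norm (D (Y + v * real m)) \<le> (Y + v * real m) powr (- (3 / 2)) + c * (Y + v * real m) powr (- (5 / 2))"
        unfolding D_def s_def t2 c_def .
    qed (intro summable_add summable_mult s3 s5)
    also have "\<dots> = (\<Sum>m. (Y + v * real m) powr (- (3 / 2))) + c * (\<Sum>m. (Y + v * real m) powr (- (5 / 2)))"
      by (simp only: suminf_add[symmetric] suminf_mult s3 s5 summable_mult)
    also have "\<dots> \<le> (Y powr (- (3 / 2)) + Y powr (1 - 3 / 2) / (v * (3 / 2 - 1))) + c * (Y powr (- (5 / 2)) + Y powr (1 - 5 / 2) / (v * (5 / 2 - 1)))"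
      using Y(3) v c0 by (intro add_mono mult_left_mono suminf_powr_le) auto
    also have "\<dots> \<le> (1 + 2 / v) + c * ((1 + 1 / v) * (1 / r ^ 27))"
    proof (intro add_mono mult_left_mono)
      show "Y powr (- (3 / 2)) \<le> 1" using powr_mono[of "- (3 / 2)" 0 Y] Y(3,4) by simp
      have "Y powr (1 - 3 / 2) \<le> 1" using powr_mono[of "1 - 3 / 2" 0 Y] Y(3,4) by simp
      thus "Y powr (1 - 3 / 2) / (v * (3 / 2 - 1)) \<le> 2 / v" using v by (simp add: field_simps)
      have a: "Y powr (- (3 / 2)) \<le> 1 / r ^ 27"
      proof -
        have "Y powr (- (3 / 2)) \<le> (r ^ 18) powr (- (3 / 2))"
          using Y(1) rp by (intro powr_mono2') auto
        also have "\<dots> = 1 / r ^ 27" using rp by (simp add: power_powr powr_minus inverse_eq_divide)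
        finally show ?thesis .
      qed
      have "Y powr (- (5 / 2)) \<le> Y powr (- (3 / 2))" using Y(4) by (intro powr_mono) auto
      hence b: "Y powr (- (5 / 2)) \<le> 1 / r ^ 27" using a by linarith
      have "Y powr (1 - 5 / 2) / (v * (5 / 2 - 1)) \<le> Y powr (- (3 / 2)) / v"
        using v by (simp add: field_simps)
      also have "\<dots> \<le> 1 / r ^ 27 / v" using a v by (intro divide_right_mono) auto
      finally have "Y powr (1 - 5 / 2) / (v * (5 / 2 - 1)) \<le> 1 / v * (1 / r ^ 27)" by (simp add: mult.commute)
      thus "Y powr (- (5 / 2)) + Y powr (1 - 5 / 2) / (v * (5 / 2 - 1)) \<le> (1 + 1 / v) * (1 / r ^ 27)"
        using b unfolding distrib_right mult_1_left by linarith
    qed (rule c0)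
    also have "c * ((1 + 1 / v) * (1 / r ^ 27)) = 12 * w * (1 + 1 / v) * r ^ 5"
    proof -
      have "r ^ 5 * r ^ 27 / r ^ 27 = r ^ 5"
        by (rule nonzero_mult_div_cancel_right) (use rp in simp)
      moreover have "r ^ 5 * r ^ 27 = r ^ 32" by (simp flip: power_add)
      ultimately have "r ^ 32 / r ^ 27 = r ^ 5" by (simp only:)
      moreover have "c * ((1 + 1 / v) * (1 / r ^ 27)) = 12 * w * (1 + 1 / v) * (r ^ 32 / r ^ 27)"
        by (simp add: c_def)
      ultimately show ?thesis by (simp only:)
    qed
    also have "(1 + 2 / v) + 12 * w * (1 + 1 / v) * r ^ 5 \<le> (1 + 2 / v) * (r ^ 5 * \<Lambda>\<^sup>2) + 12 * w * (1 + 1 / v) * (r ^ 5 * \<Lambda>\<^sup>2)"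
    proof -
      have L2: "\<Lambda>\<^sup>2 \<ge> 1" using \<Lambda> by (rule one_le_power)
      have a: "r ^ 5 \<le> r ^ 5 * \<Lambda>\<^sup>2" using mult_left_mono[OF L2, of "r ^ 5"] rp by simp
      have b: "1 \<le> r ^ 5 * \<Lambda>\<^sup>2" using a one_le_power[OF r, of 5] by linarith
      have "(1 + 2 / v) * 1 \<le> (1 + 2 / v) * (r ^ 5 * \<Lambda>\<^sup>2)" using b v by (intro mult_left_mono) auto
      moreover have "12 * w * (1 + 1 / v) * r ^ 5 \<le> 12 * w * (1 + 1 / v) * (r ^ 5 * \<Lambda>\<^sup>2)"
        using a v w by (intro mult_left_mono) auto
      ultimately show ?thesis by simp
    qed
    also have "\<dots> = ((1 + 2 / v) + 12 * w * (1 + 1 / v)) * (r ^ 5 * \<Lambda>\<^sup>2)"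
      by (simp only: distrib_right)
    finally show "norm (\<Sum>m. D (Y + v * real m)) \<le> ((1 + 2 / v) + 12 * w * (1 + 1 / v)) * (r ^ 5 * \<Lambda>\<^sup>2)" .
  qed
  also have "\<dots> = (rest_const \<alpha> w * (1 / \<alpha> + (2 + \<bar>ln \<alpha>\<bar>) / v) + (1 + 2 / v) + 12 * w * (1 + 1 / v)) * (r ^ 5 * \<Lambda>\<^sup>2)"
    by (simp only: distrib_right add_ac)
  finally show ?thesis by (simp only: D_def s_def \<Lambda>_def)
qed

section \<open>The bounded term and the conclusion\<close>

lemma norm_tent_integral_hurwitz_le:
  assumes "v > 0" "\<alpha> > 0" "Re s = 3 / 2"
  shows "norm (tent_integral v (lattice_sum v pw) (s - 1) \<alpha>) \<le> v * (\<alpha> powr (- (3 / 2)) + \<alpha> powr (1 - 3 / 2) / (v * (3 / 2 - 1))) * v"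
proof -
  define B where "B = \<alpha> powr (- (3 / 2)) + \<alpha> powr (1 - 3 / 2) / (v * (3 / 2 - 1))"
  have H: "norm (lattice_sum v pw s (\<alpha> + u)) \<le> B" if u: "u \<ge> 0" for u
  proof -
    have pos: "\<alpha> + u + v * real n > 0" for n using assms u by (simp add: add_pos_nonneg)
    have sm: "summable (\<lambda>n. norm (pw s (\<alpha> + u + v * real n)))"
      by (rule summable_lattice_sum[OF assms(1) decaying_pw]) (use assms u in auto)
    have n: "norm (pw s (\<alpha> + u + v * real n)) = (\<alpha> + u + v * real n) powr (- (3 / 2))" for n
      using norm_pw[OF pos[of n], of s] assms(3) by simp
    have "norm (lattice_sum v pw s (\<alpha> + u)) \<le> (\<Sum>n. norm (pw s (\<alpha> + u + v * real n)))"
      unfolding lattice_sum_def by (rule summable_norm[OF sm])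
    also have "\<dots> \<le> (\<alpha> + u) powr (- (3 / 2)) + (\<alpha> + u) powr (1 - 3 / 2) / (v * (3 / 2 - 1))"
      unfolding n by (rule suminf_powr_le) (use assms u in auto)
    also have "\<dots> \<le> B"
      unfolding B_def using assms u by (intro add_mono divide_right_mono powr_mono2') auto
    finally show ?thesis .
  qed
  \<comment> \<open>The integrand involves the Hurwitz series at real part \<open>3/2\<close>, where
    it converges absolutely, so the bound is independent of \<open>Im s\<close>.\<close>
  have "norm (integral {0..v} (\<lambda>u. of_real (v - u) * lattice_sum v pw (s - 1 + 1) (\<alpha> + u))) \<le> integral {0..v} (\<lambda>u. v * B)"
  proof (rule integral_norm_bound_integral)
    show "(\<lambda>u. of_real (v - u) * lattice_sum v pw (s - 1 + 1) (\<alpha> + u)) integrable_on {0..v}"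
      using tent_integral_integrable[OF regular_hurwitz[OF assms(1)], of "s - 1" \<alpha> v] assms by simp
    fix u assume u: "u \<in> {0..v}"
    have "norm (of_real (v - u) * lattice_sum v pw (s - 1 + 1) (\<alpha> + u)) = (v - u) * norm (lattice_sum v pw s (\<alpha> + u))"
      using u unfolding norm_mult norm_of_real by simp
    also have "\<dots> \<le> v * B" using u H[of u] assms by (intro mult_mono) auto
    finally show "norm (of_real (v - u) * lattice_sum v pw (s - 1 + 1) (\<alpha> + u)) \<le> v * B" .
  qed (rule integrable_const_ivl)
  also have "\<dots> = v * B * v" using assms by simp
  finally show ?thesis by (simp only: tent_integral_def B_def)
qed

theorem theorem1p4:
  fixes \<alpha> v w :: real
  assumes "\<alpha> > 0" and "v > 0" and "w > 0"
  shows "(\<lambda>t::real. norm (barnes_zeta2 \<alpha> v w (Complex (3/2) t)))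
           \<in> O[at_infinity](\<lambda>t. \<bar>t\<bar> powr (1/3))"
proof -
  define C1 where "C1 = rest_const \<alpha> w * (1 / \<alpha> + (2 + \<bar>ln \<alpha>\<bar>) / v) + (1 + 2 / v) + 12 * w * (1 + 1 / v)"
  define C2 where "C2 = v * (\<alpha> powr (- (3 / 2)) + \<alpha> powr (1 - 3 / 2) / (v * (3 / 2 - 1))) * v / (v * w)"
  define C3 where "C3 = \<alpha> powr (1 / 2) / (v * w)"
  have C: "C2 \<ge> 0" "C3 \<ge> 0" using assms by (auto simp: C2_def C3_def)
  define F where "F x = x powr (5 / 16) * (1 + ln x)\<^sup>2" for x :: real
  \<comment> \<open>\<open>\<bar>t\<bar> \<ge> M ^ 16\<close> amounts to \<open>r \<ge> M\<close>;
    then every size condition of the preceding bounds, against \<open>1\<close>,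
    \<open>2 * w\<close>, \<open>v\<close> and \<open>\<alpha>\<close>, holds at once, powers of
    \<open>r\<close> being at least \<open>r\<close>.\<close>
  define M where "M = max 1 (max (2 * w) (max v (\<alpha> + 1)))"
  have bound: "norm (barnes_zeta2 \<alpha> v w (Complex (3/2) t)) \<le> (C1 + C2 + C3) * F \<bar>t\<bar>"
    if t: "\<bar>t\<bar> \<ge> M ^ 16" for t
  proof -
    have M: "M \<ge> 1" "M \<ge> 2 * w" "M \<ge> v" "M > \<alpha>" by (auto simp: M_def)
    have t1: "\<bar>t\<bar> \<ge> 1" using t one_le_power[OF M(1), of 16] by linarith
    define r where "r = \<bar>t\<bar> powr (1 / 16)"
    have r16: "\<bar>t\<bar> = r ^ 16"
      unfolding r_def using t1 by (simp add: powr_power)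
    have "r \<ge> M"
    proof (rule ccontr)
      assume "\<not> M \<le> r"
      hence "r ^ 16 < M ^ 16" by (intro power_strict_mono) (auto simp: r_def)
      thus False using t r16 by linarith
    qed
    have r: "r \<ge> 1" "M \<le> r ^ k" if "k > 0" for k
      using \<open>r \<ge> M\<close> M(1) self_le_power[of r k] that by auto
    have r1: "r \<ge> 1" using \<open>r \<ge> M\<close> M(1) by linarith
    have lnr: "ln \<bar>t\<bar> = 16 * ln r" unfolding r16 using r1 by (simp add: ln_realpow)
    have r5: "r ^ 5 = \<bar>t\<bar> powr (5 / 16)"
      unfolding r_def using t1 by (simp add: powr_power)
    have F: "F \<bar>t\<bar> = r ^ 5 * (1 + 16 * ln r)\<^sup>2" unfolding F_def lnr r5 ..
    have F1: "F \<bar>t\<bar> \<ge> 1"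
      unfolding F using r1 mult_mono[of 1 "r ^ 5" 1 "(1 + 16 * ln r)\<^sup>2"] by (simp add: one_le_power)
    define s where "s = 3 / 2 + \<i> * complex_of_real t"
    have s: "Complex (3/2) t = s" by (simp add: s_def complex_eq_iff)
    have Re: "Re s = 3 / 2" and Im: "Im s = t" by (simp_all add: s_def)
    have "s \<noteq> 2" using Re by auto
    hence "barnes_zeta2 \<alpha> v w s = pw (s - 2) \<alpha> / (v * w * (s - 1) * (s - 2)) +
      tent_integral v (lattice_sum v pw) (s - 1) \<alpha> / (v * w) + (\<Sum>m. euler_maclaurin_rest w s (\<alpha> + v * real m))"
      unfolding euler_maclaurin_rest_def using barnes_zeta2_eq[OF assms, of s] Re by simp
    also have "norm \<dots> \<le> C3 + C2 + C1 * F \<bar>t\<bar>"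
    proof (intro norm_triangle_mono)
      have s1: "norm (s - 1) \<ge> 1" "norm (s - 2) \<ge> 1"
        using abs_Im_le_cmod[of "s - 1"] abs_Im_le_cmod[of "s - 2"] Im t1 by auto
      hence "1 * 1 \<le> norm (s - 1) * norm (s - 2)" by (intro mult_mono) auto
      hence 1: "v * w * 1 \<le> v * w * (norm (s - 1) * norm (s - 2))" using assms by (intro mult_left_mono) auto
      have "norm (pw (s - 2) \<alpha> / (v * w * (s - 1) * (s - 2))) = \<alpha> powr (1 / 2) / (v * w * (norm (s - 1) * norm (s - 2)))"
        using norm_pw[OF assms(1), of "s - 2"] Re assms by (simp add: norm_divide norm_mult mult.assoc)
      also have "\<dots> \<le> \<alpha> powr (1 / 2) / (v * w * 1)"
        using 1 assms by (intro divide_left_mono mult_pos_pos) auto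
      finally show "norm (pw (s - 2) \<alpha> / (v * w * (s - 1) * (s - 2))) \<le> C3" by (simp add: C3_def)
      have "norm (tent_integral v (lattice_sum v pw) (s - 1) \<alpha> / (v * w)) = norm (tent_integral v (lattice_sum v pw) (s - 1) \<alpha>) / (v * w)"
        using assms by (simp add: norm_divide norm_mult)
      also have "\<dots> \<le> C2"
        unfolding C2_def using norm_tent_integral_hurwitz_le[OF assms(2,1) Re] assms
        by (intro divide_right_mono) auto
      finally show "norm (tent_integral v (lattice_sum v pw) (s - 1) \<alpha> / (v * w)) \<le> C2" .
      show "norm (\<Sum>m. euler_maclaurin_rest w s (\<alpha> + v * real m)) \<le> C1 * F \<bar>t\<bar>"
        unfolding C1_def F s_def
        by (rule norm_rest_suminf_le[OF assms(2,3,1) r1 r16]) (use M r(2)[of 8] r(2)[of 18] in auto)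
    qed
    also have "\<dots> \<le> (C1 + C2 + C3) * F \<bar>t\<bar>"
      using mult_left_mono[OF F1 C(1)] mult_left_mono[OF F1 C(2)] by (simp add: algebra_simps)
    finally show ?thesis by (simp only: s)
  qed
  \<comment> \<open>The room between 5/16 and 1/3 is 1/48. Each of the two logarithmic factors takes
    half of it: \<open>ln x\<close> is at most 96 times \<open>x powr (1 / 96)\<close>, and adding
    \<open>1\<close> gives the constant 97.\<close>
  have F_le: "F x \<le> 97\<^sup>2 * x powr (1 / 3)" if "x \<ge> 1" for x
  proof -
    have "ln x \<le> x powr (1 / 96) / (1 / 96)" using that by (intro ln_powr_bound) auto
    moreover have "1 \<le> x powr (1 / 96)" using that by (intro ge_one_powr_ge_zero) auto
    ultimately have "1 + ln x \<le> 97 * x powr (1 / 96)" by simp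
    hence "(1 + ln x)\<^sup>2 \<le> (97 * x powr (1 / 96))\<^sup>2" using that by (intro power_mono) auto
    also have "\<dots> = 97\<^sup>2 * x powr (1 / 48)" using that by (simp add: power_mult_distrib powr_power)
    finally have "F x \<le> x powr (5 / 16) * (97\<^sup>2 * x powr (1 / 48))"
      unfolding F_def by (rule mult_left_mono) simp
    also have "\<dots> = 97\<^sup>2 * x powr (1 / 3)" by (simp flip: powr_add)
    finally show ?thesis .
  qed
  have "\<forall>\<^sub>F t::real in at_infinity. \<bar>t\<bar> \<ge> M ^ 16"
    unfolding eventually_at_infinity by (intro exI[of _ "M ^ 16"]) simp
  moreover have "norm (norm (barnes_zeta2 \<alpha> v w (Complex (3/2) t))) \<le> (\<bar>C1 + C2 + C3\<bar> * 97\<^sup>2) * norm (\<bar>t\<bar> powr (1 / 3))"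
    if t: "\<bar>t\<bar> \<ge> M ^ 16" for t
  proof -
    have "M ^ 16 \<ge> 1" by (intro one_le_power) (simp add: M_def)
    hence "F \<bar>t\<bar> \<le> 97\<^sup>2 * \<bar>t\<bar> powr (1 / 3)" using t by (intro F_le) simp
    moreover have "F \<bar>t\<bar> \<ge> 0" by (simp add: F_def)
    ultimately have "(C1 + C2 + C3) * F \<bar>t\<bar> \<le> \<bar>C1 + C2 + C3\<bar> * (97\<^sup>2 * \<bar>t\<bar> powr (1 / 3))"
      by (intro mult_mono) auto
    thus ?thesis using bound[OF t] by simp
  qed
  ultimately show ?thesis
    by (intro bigoI) (rule eventually_mono)
qed

end
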